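(* Let $d\ge 2$, $N\ge 2$, $\gamma>0$, $\beta>0$, and let $V$ satisfy the assumptions listed in the context. For any $a\in(0,\beta)$ there exist $W\in C^2(\mathcal X,(0,\infty))$ and $\Psi\in C^2(\mathcal X,\mathbf R)$ satisfying the following: (i) $W(\mathbf x)=e^{aH(\mathbf x)+\Psi(\mathbf x)}$ for all $\mathbf x\in\mathcal X$, and $\Psi(\mathbf x)=o(H(\mathbf x))$ as $H(\mathbf x)\to\infty$. As a consequence, $W(\mathbf x)\to\infty$ as $H(\mathbf x)\to\infty$. (ii) There exist constants $\lambda,C>0$, depending on $N$, such that for all $\mathbf x\in\mathcal X$ $$\mathcal L W(\mathbf x)\le-\lambda W(\mathbf x)+C.$$
   Context: Potential and Hamiltonian. Write $\mathbf q=(q_1,\dots,q_N)\in(\mathbf R^d)^N$ and $\mathbf p=(p_1,\dots,p_N)\in(\mathbf R^d)^N$. The Coulomb kernel is $K(x)=-\log|x|$ if $d=2$ and $K(x)=|x|^{2-d}$ if $d\ge3$. Set $$U(\mathbf q)=\sum_{i=1}^N V(q_i)+\frac1{2N}\sum_{1\le i\ne j\le N}K(q_i-q_j),\qquad H(\mathbf q,\mathbf p)=\frac12|\mathbf p|^2+U(\mathbf q).$$ Assumptions on $V:\mathbf R^d\to\mathbf R$. $V$ is twice continuously differentiable and: (i) $V\ge0$, and there are constants $c_1,c_2,c_3,M>0$ such that for all $q\in\mathbf R^d$: $V(q)\ge c_1|q|^2-M$ and $c_2V(q)-M\le\nabla V(q)\cdot q\le c_3V(q)+M$; (ii) for every $\varepsilon>0$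 there is $M_\varepsilon>0$ such that $|\nabla V(q)|\le\varepsilon V(q)+M_\varepsilon$ for all $q\in\mathbf R^d$. State space. $\mathcal D=\{\mathbf q\in(\mathbf R^d)^N: q_i\ne q_j \text{ for } i\ne j\}$ (the set where $U<\infty$) and $\mathcal X=\mathcal D\times(\mathbf R^d)^N$; points are written $\mathbf x=(\mathbf q,\mathbf p)$. Generator. For $f\in C^2(\mathcal X)$, $$\mathcal L f=\mathbf p\cdot\nabla_{\mathbf q}f-\gamma\,\mathbf p\cdot\nabla_{\mathbf p}f-\nabla_{\mathbf q}U(\mathbf q)\cdot\nabla_{\mathbf p}f+\gamma\beta^{-1}\Delta_{\mathbf p}f.$$ The statement $\Psi(\mathbf x)=o(H(\mathbf x))$ as $H(\mathbf x)\to\infty$ means: for every $\varepsilon>0$ there is $R>0$ such that $|\Psi(\mathbf x)|\le\varepsilon H(\mathbf x)$ whenever $H(\mathbf x)\ge R$. *)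

theory Defs
  imports "HOL-Analysis.Analysis"
begin

text \<open>
  \<open>f \<in> C\<^sup>2(S)\<close> for an open set \<open>S\<close>. Functions on \<open>S\<close> are represented by total functions, of
  which only the values on \<open>S\<close> matter.
\<close>

definition C2_on :: "('a::real_normed_vector \<Rightarrow> real) \<Rightarrow> 'a set \<Rightarrow> bool" where
  "C2_on f S \<longleftrightarrow>
    (\<exists>(f' :: 'a \<Rightarrow> 'a \<Rightarrow>\<^sub>L real) (f'' :: 'a \<Rightarrow> 'a \<Rightarrow>\<^sub>L 'a \<Rightarrow>\<^sub>L real).
      (\<forall>x\<in>S. (f has_derivative blinfun_apply (f' x)) (at x)) \<and>
      (\<forall>x\<in>S. (f' has_derivative blinfun_apply (f'' x)) (at x)) \<and>
      continuous_on S f'')"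

definition grad :: "('a::euclidean_space \<Rightarrow> real) \<Rightarrow> 'a \<Rightarrow> 'a" where
  "grad f x = (THE D. GDERIV f x :> D)"

definition laplacian :: "('a::euclidean_space \<Rightarrow> real) \<Rightarrow> 'a \<Rightarrow> real" where
  "laplacian f x = (\<Sum>b\<in>Basis. (deriv ^^ 2) (\<lambda>t. f (x + t *\<^sub>R b)) 0)"

text \<open>
  The dimension is \<open>d = CARD('d)\<close> and the number of particles is \<open>N = CARD('n)\<close>. The value of the
  kernel at the origin is irrelevant, since \<open>U\<close> is only used on \<open>config_space\<close>.
\<close>

definition coulomb_kernel :: "real ^ 'd \<Rightarrow> real" where
  "coulomb_kernel x =
    (if CARD('d) = 2 then - ln (norm x) else norm x powi (2 - int CARD('d)))"

definition potential_energy :: "(real ^ 'd \<Rightarrow> real) \<Rightarrow> (real ^ 'd) ^ 'n \<Rightarrow> real" where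
  "potential_energy V q =
    (\<Sum>i\<in>UNIV. V (q $ i)) +
    1 / (2 * real CARD('n)) * (\<Sum>i\<in>UNIV. \<Sum>j\<in>UNIV - {i}. coulomb_kernel (q $ i - q $ j))"

definition hamiltonian ::
  "(real ^ 'd \<Rightarrow> real) \<Rightarrow> ((real ^ 'd) ^ 'n) \<times> ((real ^ 'd) ^ 'n) \<Rightarrow> real" where
  "hamiltonian V = (\<lambda>(q, p). 1 / 2 * (norm p)\<^sup>2 + potential_energy V q)"

definition confining_potential :: "(real ^ 'd \<Rightarrow> real) \<Rightarrow> bool" where
  "confining_potential V \<longleftrightarrow>
    C2_on V UNIV \<and>
    (\<forall>q. V q \<ge> 0) \<and>
    (\<exists>c1 c2 c3 M. c1 > 0 \<and> c2 > 0 \<and> c3 > 0 \<and> M > 0 \<and>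
      (\<forall>q. V q \<ge> c1 * (norm q)\<^sup>2 - M \<and>
           c2 * V q - M \<le> grad V q \<bullet> q \<and> grad V q \<bullet> q \<le> c3 * V q + M)) \<and>
    (\<forall>\<epsilon>>0. \<exists>M\<^sub>\<epsilon>>0. \<forall>q. norm (grad V q) \<le> \<epsilon> * V q + M\<^sub>\<epsilon>)"

definition config_space :: "((real ^ 'd) ^ 'n) set" where
  "config_space = {q. \<forall>i j. i \<noteq> j \<longrightarrow> q $ i \<noteq> q $ j}"

definition phase_space :: "(((real ^ 'd) ^ 'n) \<times> ((real ^ 'd) ^ 'n)) set" where
  "phase_space = config_space \<times> UNIV"

definition generator ::
  "(real ^ 'd \<Rightarrow> real) \<Rightarrow> real \<Rightarrow> real \<Rightarrow>
   (((real ^ 'd) ^ 'n) \<times> ((real ^ 'd) ^ 'n) \<Rightarrow> real) \<Rightarrow>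
   ((real ^ 'd) ^ 'n) \<times> ((real ^ 'd) ^ 'n) \<Rightarrow> real" where
  "generator V \<gamma> \<beta> f = (\<lambda>(q, p).
     p \<bullet> grad (\<lambda>q'. f (q', p)) q
     - \<gamma> * (p \<bullet> grad (\<lambda>p'. f (q, p')) p)
     - grad (potential_energy V) q \<bullet> grad (\<lambda>p'. f (q, p')) p
     + \<gamma> * inverse \<beta> * laplacian (\<lambda>p'. f (q, p')) p)"

definition little_o_hamiltonian ::
  "(real ^ 'd \<Rightarrow> real) \<Rightarrow> (((real ^ 'd) ^ 'n) \<times> ((real ^ 'd) ^ 'n) \<Rightarrow> real) \<Rightarrow> bool" where
  "little_o_hamiltonian V \<Psi> \<longleftrightarrow>
    (\<forall>\<epsilon>>0. \<exists>R>0. \<forall>x\<in>phase_space. hamiltonian V x \<ge> R \<longrightarrow> \<bar>\<Psi> x\<bar> \<le> \<epsilon> * hamiltonian V x)"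

text \<open>The filter of \<open>H(x) \<rightarrow> \<infinity>\<close> with \<open>x\<close> ranging over the phase space.\<close>

definition hamiltonian_at_top ::
  "(real ^ 'd \<Rightarrow> real) \<Rightarrow> (((real ^ 'd) ^ 'n) \<times> ((real ^ 'd) ^ 'n)) filter" where
  "hamiltonian_at_top V = inf (filtercomap (hamiltonian V) at_top) (principal phase_space)"

end

theory Submission
  imports Defs
begin

text \<open>
  The correction is \<open>\<Psi>(q,p) = F(q) \<bullet> p\<close> with the bounded vector field
  \<open>F(q)\<^sub>i = w(q) (\<delta> q\<^sub>i + \<Sum>\<^sub>j sgn (q\<^sub>j - q\<^sub>i))\<close>, \<open>w(q) = (1 + \<eta> |q|\<^sup>2)\<^sup>-\<^sup>1\<^sup>/\<^sup>2\<close>. Writing \<open>G = a H + \<Psi>\<close>,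
  \<open>e\<^sup>-\<^sup>G \<L> e\<^sup>G\<close> equals \<open>DF(q)[p] \<bullet> p - \<nabla>U \<bullet> F - \<gamma> a (1 - a/\<beta>) |p|\<^sup>2\<close> plus terms that are at most linear
  in \<open>p\<close>. The attractive part of \<open>F\<close> is minus the gradient of the convex function \<open>\<Sum>|q\<^sub>i - q\<^sub>j|\<close>
  (over unordered pairs), so up to the small parameters \<open>\<delta>\<close> and \<open>\<eta>\<close> the quadratic form \<open>DF\<close> is
  nonpositive, although it is unbounded near collisions. Conversely \<open>\<nabla>U \<bullet> F\<close> tends to infinity with \<open>U\<close>: near
  collisions because \<open>sgn\<close> is monotone, so that third particles never spoil the attraction within a
  pair, and at infinity because of the linear part. The weight \<open>w\<close> makes \<open>F\<close> bounded, whence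
  \<open>\<Psi> = o(H)\<close>; it costs only a square root of the growth.
\<close>

subsection \<open>Calculus of twice continuously differentiable functions\<close>

text \<open>Vector-valued so that it applies to the derivative itself: \<open>C2_on f S\<close> says
  that the derivative, a map into bounded linear functionals, is \<open>C1_on\<close>. Closure
  properties of \<open>C2_on\<close> thus reduce to those of \<open>C1_on\<close>.\<close>

definition C1_on :: "('a::real_normed_vector \<Rightarrow> 'b::real_normed_vector) \<Rightarrow> 'a set \<Rightarrow> bool" where
  "C1_on f S \<longleftrightarrow> (\<exists>f' :: 'a \<Rightarrow> 'a \<Rightarrow>\<^sub>L 'b.
     (\<forall>x\<in>S. (f has_derivative blinfun_apply (f' x)) (at x)) \<and> continuous_on S f')"

lemma C2_on_iff: "C2_on f S \<longleftrightarrow> (\<exists>f'. (\<forall>x\<in>S. (f has_derivative blinfun_apply (f' x)) (at x)) \<and> C1_on f' S)"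
  unfolding C2_on_def C1_on_def by blast

lemma C1_on_continuous_on: "C1_on f S \<Longrightarrow> continuous_on S f"
  unfolding C1_on_def by (meson continuous_at_imp_continuous_on has_derivative_continuous)

lemma C2_on_imp_C1_on: "C2_on f S \<Longrightarrow> C1_on f S"
  unfolding C2_on_iff using C1_on_continuous_on by (auto simp: C1_on_def)

lemma C1_on_const: "C1_on (\<lambda>_. c) S"
  unfolding C1_on_def by (rule exI[of _ "\<lambda>_. 0"]) (auto simp: zero_blinfun.rep_eq)

lemma C1_on_add:
  assumes "C1_on f S" "C1_on g S"
  shows "C1_on (\<lambda>x. f x + g x) S"
proof -
  obtain f' g' where "\<forall>x\<in>S. (f has_derivative blinfun_apply (f' x)) (at x)" "continuous_on S f'"
     "\<forall>x\<in>S. (g has_derivative blinfun_apply (g' x)) (at x)" "continuous_on S g'"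
    using assms unfolding C1_on_def by metis
  then show ?thesis unfolding C1_on_def
    by (intro exI[of _ "\<lambda>x. f' x + g' x"])
       (auto simp: plus_blinfun.rep_eq intro!: continuous_intros derivative_eq_intros)
qed

text \<open>The product rule for any bounded bilinear map. It is instantiated with scaling, for
  derivatives of products and of scalar compositions, and with composition of bounded linear maps,
  for linear changes of variable.\<close>

lemma (in bounded_bilinear) C1_on:
  assumes "C1_on f S" "C1_on g S"
  shows "C1_on (\<lambda>x. prod (f x) (g x)) S"
proof -
  obtain f' g' where f: "\<And>x. x \<in> S \<Longrightarrow> (f has_derivative blinfun_apply (f' x)) (at x)" "continuous_on S f'"
     and g: "\<And>x. x \<in> S \<Longrightarrow> (g has_derivative blinfun_apply (g' x)) (at x)" "continuous_on S g'"
    using assms unfolding C1_on_def by metis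
  have c: "continuous_on S f" "continuous_on S g"
    using assms C1_on_continuous_on by auto
  show ?thesis unfolding C1_on_def
  proof (intro exI[of _ "\<lambda>x. (prod_right (f x) o\<^sub>L g' x) + (prod_left (g x) o\<^sub>L f' x)"] conjI ballI)
    fix x assume "x \<in> S"
    show "((\<lambda>x. prod (f x) (g x)) has_derivative
           blinfun_apply ((prod_right (f x) o\<^sub>L g' x) + (prod_left (g x) o\<^sub>L f' x))) (at x)"
      by (rule has_derivative_eq_rhs[OF FDERIV[OF f(1) g(1)]])
         (use \<open>x \<in> S\<close> in \<open>auto simp: plus_blinfun.rep_eq prod_right.rep_eq prod_left.rep_eq\<close>)
  next
    show "continuous_on S (\<lambda>x. (prod_right (f x) o\<^sub>L g' x) + (prod_left (g x) o\<^sub>L f' x))"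
      by (intro continuous_intros bounded_linear.continuous_on[OF bounded_linear_prod_right]
           bounded_linear.continuous_on[OF bounded_linear_prod_left] c f g)
  qed
qed

lemma C1_on_compose_bounded_linear:
  assumes L: "bounded_linear L" and "C1_on f T" and T: "\<And>x. x \<in> S \<Longrightarrow> L x \<in> T"
  shows "C1_on (\<lambda>x. f (L x)) S"
proof -
  obtain f' where f: "\<And>x. x \<in> T \<Longrightarrow> (f has_derivative blinfun_apply (f' x)) (at x)" "continuous_on T f'"
    using assms unfolding C1_on_def by metis
  show ?thesis unfolding C1_on_def
  proof (intro exI[of _ "\<lambda>x. f' (L x) o\<^sub>L Blinfun L"] conjI ballI)
    fix x assume "x \<in> S"
    have "(L has_derivative L) (at x)" using L by (rule bounded_linear_imp_has_derivative)
    from has_derivative_compose[OF this f(1)[OF T[OF \<open>x \<in> S\<close>]]]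
    show "((\<lambda>x. f (L x)) has_derivative blinfun_apply (f' (L x) o\<^sub>L Blinfun L)) (at x)"
      by (rule has_derivative_eq_rhs) (auto simp: bounded_linear_Blinfun_apply L)
  next
    have "continuous_on S (\<lambda>x. f' (L x))"
      by (rule continuous_on_compose2[OF f(2) linear_continuous_on[OF L]]) (use T in auto)
    then show "continuous_on S (\<lambda>x. f' (L x) o\<^sub>L Blinfun L)"
      by (intro continuous_intros)
  qed
qed

section \<open>Closure of \<open>C2_on\<close> under algebraic operations and composition\<close>

lemma C2_on_const: "C2_on (\<lambda>_. c) S"
  unfolding C2_on_iff
  by (rule exI[of _ "\<lambda>_. 0"]) (auto simp: zero_blinfun.rep_eq C1_on_const)

lemma C2_on_bounded_linear:
  assumes "bounded_linear f" shows "C2_on f S"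
  unfolding C2_on_iff
  by (rule exI[of _ "\<lambda>_. Blinfun f"])
     (auto simp: bounded_linear_Blinfun_apply assms bounded_linear_imp_has_derivative C1_on_const)

lemma C2_on_add:
  assumes "C2_on f S" "C2_on g S"
  shows "C2_on (\<lambda>x. f x + g x) S"
proof -
  obtain f' g' where "\<forall>x\<in>S. (f has_derivative blinfun_apply (f' x)) (at x)" "C1_on f' S"
     "\<forall>x\<in>S. (g has_derivative blinfun_apply (g' x)) (at x)" "C1_on g' S"
    using assms unfolding C2_on_iff by metis
  then show ?thesis unfolding C2_on_iff
    by (intro exI[of _ "\<lambda>x. f' x + g' x"])
       (auto simp: plus_blinfun.rep_eq intro!: C1_on_add derivative_eq_intros)
qed

lemma C2_on_mult:
  assumes "C2_on f S" "C2_on g S"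
  shows "C2_on (\<lambda>x. f x * g x) S"
proof -
  obtain f' g' where f: "\<forall>x\<in>S. (f has_derivative blinfun_apply (f' x)) (at x)" "C1_on f' S"
     and g: "\<forall>x\<in>S. (g has_derivative blinfun_apply (g' x)) (at x)" "C1_on g' S"
    using assms unfolding C2_on_iff by metis
  note sc = bounded_bilinear.C1_on[OF bounded_bilinear_scaleR]
  show ?thesis unfolding C2_on_iff
    using f g
    by (intro exI[of _ "\<lambda>x. f x *\<^sub>R g' x + g x *\<^sub>R f' x"])
       (auto simp: plus_blinfun.rep_eq scaleR_blinfun.rep_eq mult.commute
          intro!: C1_on_add sc C2_on_imp_C1_on assms derivative_eq_intros)
qed

lemma C2_on_sum:
  assumes "\<And>i. i \<in> I \<Longrightarrow> C2_on (f i) S"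
  shows "C2_on (\<lambda>x. \<Sum>i\<in>I. f i x) S"
  using assms
  by (induction I rule: infinite_finite_induct) (auto intro: C2_on_add C2_on_const)

text \<open>Expansion in the orthonormal basis turns the inner product into a finite sum of products
  of scalar linear functions.\<close>

lemma C2_on_inner:
  fixes f g :: "'a::real_normed_vector \<Rightarrow> 'b::euclidean_space"
  assumes "bounded_linear f" "bounded_linear g"
  shows "C2_on (\<lambda>x. f x \<bullet> g x) S"
proof -
  have "C2_on (\<lambda>x. \<Sum>b\<in>Basis. (f x \<bullet> b) * (g x \<bullet> b)) S"
    by (intro C2_on_sum C2_on_mult C2_on_bounded_linear bounded_linear_intros assms)
  then show ?thesis
    by (simp add: euclidean_inner[symmetric])
qed

lemma C2_on_compose_bounded_linear:
  assumes L: "bounded_linear L" and "C2_on f T" and T: "\<And>x. x \<in> S \<Longrightarrow> L x \<in> T"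
  shows "C2_on (\<lambda>x. f (L x)) S"
proof -
  obtain f' where f: "\<And>x. x \<in> T \<Longrightarrow> (f has_derivative blinfun_apply (f' x)) (at x)" "C1_on f' T"
    using assms unfolding C2_on_iff by metis
  show ?thesis unfolding C2_on_iff
  proof (intro exI[of _ "\<lambda>x. f' (L x) o\<^sub>L Blinfun L"] conjI ballI)
    fix x assume "x \<in> S"
    have "(L has_derivative L) (at x)" using L by (rule bounded_linear_imp_has_derivative)
    from has_derivative_compose[OF this f(1)[OF T[OF \<open>x \<in> S\<close>]]]
    show "((\<lambda>x. f (L x)) has_derivative blinfun_apply (f' (L x) o\<^sub>L Blinfun L)) (at x)"
      by (rule has_derivative_eq_rhs) (auto simp: bounded_linear_Blinfun_apply L)
  next
    show "C1_on (\<lambda>x. f' (L x) o\<^sub>L Blinfun L) S"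
      by (intro bounded_bilinear.C1_on[OF bounded_bilinear_blinfun_compose] C1_on_const
        C1_on_compose_bounded_linear[OF L f(2)] T)
  qed
qed

lemma C1_on_real_chain:
  fixes \<phi> :: "real \<Rightarrow> real"
  assumes f: "C1_on f S"
    and \<phi>: "\<And>x. x \<in> S \<Longrightarrow> (\<phi> has_real_derivative \<phi>' (f x)) (at (f x))"
    and c: "continuous_on (f ` S) \<phi>'"
  shows "C1_on (\<lambda>x. \<phi> (f x)) S"
proof -
  obtain f' where f': "\<And>x. x \<in> S \<Longrightarrow> (f has_derivative blinfun_apply (f' x)) (at x)" "continuous_on S f'"
    using f unfolding C1_on_def by metis
  show ?thesis unfolding C1_on_def
  proof (intro exI[of _ "\<lambda>x. \<phi>' (f x) *\<^sub>R f' x"] conjI ballI)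
    fix x assume "x \<in> S"
    show "((\<lambda>x. \<phi> (f x)) has_derivative blinfun_apply (\<phi>' (f x) *\<^sub>R f' x)) (at x)"
      using has_derivative_compose[OF f'(1) \<phi>[unfolded has_field_derivative_def]] \<open>x \<in> S\<close>
      by (auto simp: scaleR_blinfun.rep_eq)
  next
    have "continuous_on S (\<lambda>x. \<phi>' (f x))"
      by (rule continuous_on_compose2[OF c C1_on_continuous_on[OF f]]) auto
    then show "continuous_on S (\<lambda>x. \<phi>' (f x) *\<^sub>R f' x)"
      using f'(2) by (intro continuous_intros)
  qed
qed

text \<open>The outer function is differentiated only at values taken by \<open>f\<close> on
  \<open>S\<close>, which admits \<open>ln\<close> and real powers wherever \<open>f\<close> is
  positive. The derivative is the product of the scalar \<open>\<phi>' (f x)\<close> with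
  \<open>f' x\<close>, and both factors are \<open>C1_on\<close>.\<close>

lemma C2_on_real_chain:
  fixes \<phi> :: "real \<Rightarrow> real"
  assumes f: "C2_on f S"
    and \<phi>: "\<And>x. x \<in> S \<Longrightarrow> (\<phi> has_real_derivative \<phi>' (f x)) (at (f x))"
    and \<phi>': "\<And>x. x \<in> S \<Longrightarrow> (\<phi>' has_real_derivative \<phi>'' (f x)) (at (f x))"
    and c: "continuous_on (f ` S) \<phi>''"
  shows "C2_on (\<lambda>x. \<phi> (f x)) S"
proof -
  obtain f' where f': "\<And>x. x \<in> S \<Longrightarrow> (f has_derivative blinfun_apply (f' x)) (at x)" "C1_on f' S"
    using f unfolding C2_on_iff by metis
  show ?thesis unfolding C2_on_iff
  proof (intro exI[of _ "\<lambda>x. \<phi>' (f x) *\<^sub>R f' x"] conjI ballI)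
    fix x assume "x \<in> S"
    show "((\<lambda>x. \<phi> (f x)) has_derivative blinfun_apply (\<phi>' (f x) *\<^sub>R f' x)) (at x)"
      using has_derivative_compose[OF f'(1) \<phi>[unfolded has_field_derivative_def]] \<open>x \<in> S\<close>
      by (auto simp: scaleR_blinfun.rep_eq)
  next
    show "C1_on (\<lambda>x. \<phi>' (f x) *\<^sub>R f' x) S"
      using C1_on_real_chain[OF C2_on_imp_C1_on[OF f] \<phi>' c] f'(2)
      by (rule bounded_bilinear.C1_on[OF bounded_bilinear_scaleR])
  qed
qed

lemma C2_on_powr:
  assumes "C2_on f S" "\<And>x. x \<in> S \<Longrightarrow> f x > 0"
  shows "C2_on (\<lambda>x. f x powr s) S"
proof (rule C2_on_real_chain[OF assms(1), where \<phi>' = "\<lambda>t. s * t powr (s - 1)"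
      and \<phi>'' = "\<lambda>t. s * ((s - 1) * t powr (s - 1 - 1))"])
  fix x assume "x \<in> S"
  then have "f x > 0" using assms(2) by auto
  then show "((\<lambda>t. t powr s) has_real_derivative s * f x powr (s - 1)) (at (f x))"
    "((\<lambda>t. s * t powr (s - 1)) has_real_derivative s * ((s - 1) * f x powr (s - 1 - 1))) (at (f x))"
    by (simp_all only: DERIV_cmult has_real_derivative_powr)
next
  show "continuous_on (f ` S) (\<lambda>t. s * ((s - 1) * t powr (s - 1 - 1)))"
    by (intro continuous_intros) (use assms(2) in force)
qed

lemma C2_on_ln:
  assumes "C2_on f S" "\<And>x. x \<in> S \<Longrightarrow> f x > 0"
  shows "C2_on (\<lambda>x. ln (f x)) S"
proof (rule C2_on_real_chain[OF assms(1), where \<phi>' = inverse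
      and \<phi>'' = "\<lambda>t. - (inverse t ^ Suc (Suc 0))"])
  fix x assume "x \<in> S"
  then have "f x > 0" using assms(2) by auto
  then show "(ln has_real_derivative inverse (f x)) (at (f x))"
    "(inverse has_real_derivative - (inverse (f x) ^ Suc (Suc 0))) (at (f x))"
    by (intro DERIV_ln DERIV_inverse less_imp_neq[THEN not_sym] | assumption)+
next
  show "continuous_on (f ` S) (\<lambda>t. - (inverse t ^ Suc (Suc 0)))"
    by (intro continuous_intros) (use assms(2) in force)
qed

lemma C2_on_exp:
  assumes "C2_on f S"
  shows "C2_on (\<lambda>x. exp (f x)) S"
  by (rule C2_on_real_chain[OF assms, where \<phi>' = exp and \<phi>'' = exp])
    (auto intro: continuous_on_exp continuous_on_id)

text \<open>\<open>C2_on\<close> uses derivatives in the full space at each point. Openness of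
  \<open>S\<close> supplies a neighbourhood on which the two functions agree, so their derivatives
  agree too.\<close>

lemma C2_on_cong:
  assumes "open S" "C2_on f S" "\<And>x. x \<in> S \<Longrightarrow> f x = g x"
  shows "C2_on g S"
  using assms(2) unfolding C2_on_iff
  by (meson has_derivative_transform_within_open assms(1,3))

subsection \<open>The generator on exponentials\<close>

text \<open>\<open>grad\<close> is a definite description. Expanding the linear map \<open>D\<close>
  in the basis gives a representing vector, and uniqueness of derivatives makes it the only one, so
  any derivative that has been computed determines the gradient.\<close>

lemma grad_inner:
  fixes f :: "'a::euclidean_space \<Rightarrow> real"
  assumes "(f has_derivative D) (at x)"
  shows "grad f x \<bullet> h = D h"
proof -
  have lin: "linear D" using assms has_derivative_linear by blast
  have D: "D = (\<lambda>h. h \<bullet> (\<Sum>b\<in>Basis. D b *\<^sub>R b))"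
  proof
    fix h
    have "D h = D (\<Sum>b\<in>Basis. (h \<bullet> b) *\<^sub>R b)" by (simp add: euclidean_representation)
    also have "\<dots> = h \<bullet> (\<Sum>b\<in>Basis. D b *\<^sub>R b)"
      by (simp add: linear_sum[OF lin] linear_scale[OF lin] inner_sum_right mult.commute)
    finally show "D h = h \<bullet> (\<Sum>b\<in>Basis. D b *\<^sub>R b)" .
  qed
  have "GDERIV f x :> (\<Sum>b\<in>Basis. D b *\<^sub>R b)"
    using assms D unfolding gderiv_def by simp
  moreover have "E = E'" if "GDERIV f x :> E" "GDERIV f x :> E'" for E E'
    using has_derivative_unique[OF that[unfolded gderiv_def]]
    by (metis inner_commute inner_eq_zero_iff inner_diff_right right_minus_eq)
  ultimately have "grad f x = (\<Sum>b\<in>Basis. D b *\<^sub>R b)"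
    unfolding grad_def by (intro the_equality)
  then show ?thesis using D by (metis inner_commute)
qed

lemma grad_eqI:
  fixes f :: "'a::euclidean_space \<Rightarrow> real"
  assumes "(f has_derivative (\<lambda>h. h \<bullet> g)) (at x)"
  shows "grad f x = g"
  using grad_inner[OF assms] by (metis inner_commute vector_eq_ldot)

text \<open>Along each basis direction the exponent is a quadratic polynomial g with g'' = a, so the
  second derivative of e^g is e^g (g'^2 + a). Summing over the basis gives the squared norm of the
  momentum gradient plus \<open>a\<close> times the dimension. The constant \<open>c\<close> later
  stands for the potential part of the exponent.\<close>

lemma laplacian_exp_quadratic:
  fixes F p :: "'a::euclidean_space" and a c :: real
  shows "laplacian (\<lambda>p. exp (a * (1/2 * (norm p)\<^sup>2) + c + F \<bullet> p)) p =
    exp (a * (1/2 * (norm p)\<^sup>2) + c + F \<bullet> p) * ((norm (a *\<^sub>R p + F))\<^sup>2 + a * DIM('a))"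
proof -
  have *: "(deriv ^^ 2) (\<lambda>t. exp (a * (1/2 * (norm (p + t *\<^sub>R b))\<^sup>2) + c + F \<bullet> (p + t *\<^sub>R b))) 0
    = exp (a * (1/2 * (norm p)\<^sup>2) + c + F \<bullet> p) * (((a *\<^sub>R p + F) \<bullet> b)\<^sup>2 + a)"
    if b: "b \<in> Basis" for b
  proof -
    have sq: "(norm (p + t *\<^sub>R b))\<^sup>2 = (norm p)\<^sup>2 + 2 * t * (p \<bullet> b) + t\<^sup>2" for t
      unfolding power2_norm_eq_inner using b
      by (simp add: inner_add_left inner_add_right inner_commute algebra_simps power2_eq_square)
    define g where "g t = a * (1/2 * ((norm p)\<^sup>2 + 2 * t * (p \<bullet> b) + t\<^sup>2)) + c + F \<bullet> p + t * (F \<bullet> b)" for t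
    define g' where "g' t = a * (p \<bullet> b) + a * t + F \<bullet> b" for t
    have g: "(g has_real_derivative g' t) (at t)" for t
      unfolding g_def[abs_def] g'_def by (auto intro!: derivative_eq_intros simp: algebra_simps)
    have g': "(g' has_real_derivative a) (at t)" for t
      unfolding g'_def[abs_def] by (auto intro!: derivative_eq_intros)
    have eq: "(\<lambda>t. exp (a * (1/2 * (norm (p + t *\<^sub>R b))\<^sup>2) + c + F \<bullet> (p + t *\<^sub>R b))) = (\<lambda>t. exp (g t))"
      using sq by (auto simp: g_def inner_add_right algebra_simps)
    have "deriv (\<lambda>t. exp (g t)) = (\<lambda>t. exp (g t) * g' t)"
      by (intro ext DERIV_imp_deriv) (auto intro!: derivative_eq_intros g)
    moreover have "deriv (\<lambda>t. exp (g t) * g' t) 0 = exp (g 0) * ((g' 0)\<^sup>2 + a)"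
      by (intro DERIV_imp_deriv)
         (auto intro!: derivative_eq_intros g g' simp: power2_eq_square algebra_simps)
    ultimately show ?thesis
      unfolding eq by (simp add: numeral_2_eq_2 g_def g'_def inner_add_left)
  qed
  have "laplacian (\<lambda>p. exp (a * (1/2 * (norm p)\<^sup>2) + c + F \<bullet> p)) p =
      (\<Sum>b\<in>Basis. exp (a * (1/2 * (norm p)\<^sup>2) + c + F \<bullet> p) * (((a *\<^sub>R p + F) \<bullet> b)\<^sup>2 + a))"
    unfolding laplacian_def by (intro sum.cong refl *)
  also have "\<dots> = exp (a * (1/2 * (norm p)\<^sup>2) + c + F \<bullet> p) *
      ((\<Sum>b\<in>Basis. ((a *\<^sub>R p + F) \<bullet> b)\<^sup>2) + a * DIM('a))"
    by (simp add: sum_distrib_left[symmetric] sum.distrib mult.commute[of a])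
  also have "(\<Sum>b\<in>Basis. ((a *\<^sub>R p + F) \<bullet> b)\<^sup>2) = (norm (a *\<^sub>R p + F))\<^sup>2"
    unfolding power2_norm_eq_inner
    by (subst euclidean_inner[of "a *\<^sub>R p + F" "a *\<^sub>R p + F"]) (simp only: power2_eq_square)
  finally show ?thesis .
qed

text \<open>The two terms \<open>a * DU p\<close>, one from transport and one from the force, cancel
  because the Hamiltonian flow preserves the energy. Friction contributes -\<gamma> a |p|^2 and
  noise +\<gamma> a^2 |p|^2 / \<beta>; their sum is dissipative for 0 < a < \<beta>. Here
  \<open>D p\<close> is the quadratic form of the derivative of \<open>F\<close>.\<close>

lemma generator_exp:
  fixes V :: "real ^ 'd \<Rightarrow> real" and q p :: "(real ^ 'd) ^ 'n"
    and F :: "(real ^ 'd) ^ 'n \<Rightarrow> (real ^ 'd) ^ 'n"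
  assumes U: "(potential_energy V has_derivative DU) (at q)"
    and D: "((\<lambda>q. F q \<bullet> p) has_derivative D) (at q)"
    and W: "W = (\<lambda>x. exp (a * hamiltonian V x + F (fst x) \<bullet> snd x))"
  shows "generator V \<gamma> \<beta> W (q, p) = W (q, p) *
    (D p - DU (F q) - \<gamma> * a * (1 - a / \<beta>) * (norm p)\<^sup>2
     + \<gamma> * a / \<beta> * DIM((real ^ 'd) ^ 'n) - \<gamma> * (1 - 2 * a / \<beta>) * (F q \<bullet> p)
     + \<gamma> / \<beta> * (norm (F q))\<^sup>2)"
proof -
  have "((\<lambda>q'. W (q', p)) has_derivative (\<lambda>h. W (q, p) * (a * DU h + D h))) (at q)"
    unfolding W hamiltonian_def split fst_conv snd_conv
    by (rule derivative_eq_intros refl U D)+ (simp add: algebra_simps)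
  from grad_inner[OF this, of p]
  have 1: "p \<bullet> grad (\<lambda>q'. W (q', p)) q = W (q, p) * (a * DU p + D p)"
    by (simp add: inner_commute)
  have "((\<lambda>p'. W (q, p')) has_derivative (\<lambda>h. h \<bullet> (W (q, p) *\<^sub>R (a *\<^sub>R p + F q)))) (at p)"
    unfolding W hamiltonian_def power2_norm_eq_inner
    by (auto intro!: derivative_eq_intros simp: algebra_simps inner_commute)
  then have 2: "grad (\<lambda>p'. W (q, p')) p = W (q, p) *\<^sub>R (a *\<^sub>R p + F q)"
    by (rule grad_eqI)
  have 3: "laplacian (\<lambda>p'. W (q, p')) p
      = W (q, p) * ((norm (a *\<^sub>R p + F q))\<^sup>2 + a * DIM((real ^ 'd) ^ 'n))"
    using laplacian_exp_quadratic[of a "a * potential_energy V q" "F q" p]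
    unfolding W hamiltonian_def by (simp add: algebra_simps)
  have lin: "linear DU" using U has_derivative_linear by blast
  have 4: "grad (potential_energy V) q \<bullet> (W (q, p) *\<^sub>R (a *\<^sub>R p + F q)) = W (q, p) * (a * DU p + DU (F q))"
    unfolding grad_inner[OF U] by (simp add: linear_add[OF lin] linear_scale[OF lin])
  have 5: "(norm (a *\<^sub>R p + F q))\<^sup>2 = a\<^sup>2 * (norm p)\<^sup>2 + 2 * a * (F q \<bullet> p) + (norm (F q))\<^sup>2"
    unfolding power2_norm_eq_inner
    by (simp add: inner_add_left inner_add_right inner_commute power2_eq_square algebra_simps)
  have 6: "p \<bullet> (W (q, p) *\<^sub>R (a *\<^sub>R p + F q)) = W (q, p) * (a * (norm p)\<^sup>2 + F q \<bullet> p)"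
    unfolding power2_norm_eq_inner by (simp add: inner_add_right inner_commute algebra_simps)
  show ?thesis
    unfolding generator_def split 1 2 3 4 5 6
    by (simp add: algebra_simps power2_eq_square divide_inverse)
qed

subsection \<open>The drift field\<close>

lemma inner_self_sgn:
  fixes x :: "'a::real_inner"
  shows "x \<bullet> sgn x = norm x"
  by (cases "x = 0") (simp_all add: sgn_div_norm power2_norm_eq_inner[symmetric] power2_eq_square)

text \<open>\<open>sgn\<close> is a subgradient of the convex function \<open>norm\<close>.
  Cauchy-Schwarz against a vector of length at most 1, used twice, suffices, and this includes the
  origin, where \<open>sgn\<close> is 0.\<close>

lemma sgn_monotone:
  fixes u v :: "'a::real_inner"
  shows "(u - v) \<bullet> (sgn u - sgn v) \<ge> 0"
proof -
  have "x \<bullet> sgn y \<le> norm x" for x y :: 'a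
    using norm_cauchy_schwarz[of x "sgn y"] by (simp add: norm_sgn split: if_splits)
  from this[of u v] this[of v u] show ?thesis
    by (simp add: inner_diff_left inner_diff_right inner_self_sgn)
qed

text \<open>At \<open>x = 0\<close> this is \<open>0\<close>, which is the right value for the constant diagonal terms \<open>sgn (q $ i - q $ i)\<close>.\<close>

definition sgn_deriv :: "'a::real_inner \<Rightarrow> 'a \<Rightarrow> 'a" where
  "sgn_deriv x h = h /\<^sub>R norm x - ((x \<bullet> h) / norm x ^ 3) *\<^sub>R x"

lemma sgn_has_derivative:
  fixes x :: "'a::real_inner"
  assumes "x \<noteq> 0"
  shows "(sgn has_derivative sgn_deriv x) (at x)"
proof -
  have "((\<lambda>x. inverse (norm x) *\<^sub>R x) has_derivative
      (\<lambda>h. inverse (norm x) *\<^sub>R h + (- (inverse (norm x) * (h \<bullet> sgn x) * inverse (norm x))) *\<^sub>R x)) (at x)"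
    using has_derivative_scaleR[OF Deriv.has_derivative_inverse[OF _ has_derivative_norm[OF assms]] has_derivative_ident]
      assms by simp
  moreover have "sgn = (\<lambda>x::'a. inverse (norm x) *\<^sub>R x)"
    by (simp add: sgn_div_norm fun_eq_iff)
  ultimately show ?thesis
    by (auto elim!: has_derivative_eq_rhs
        simp: sgn_deriv_def sgn_div_norm fun_eq_iff power3_eq_cube inner_commute divide_inverse mult_ac)
qed

text \<open>Away from the origin \<open>sgn_deriv x\<close> is the Hessian of the norm, that is, the
  orthogonal projection off \<open>x\<close> divided by the length of \<open>x\<close>;
  Cauchy-Schwarz makes it positive semidefinite.\<close>

lemma inner_sgn_deriv_nonneg: "sgn_deriv x h \<bullet> h \<ge> 0"
proof (cases "x = 0")
  case True
  then show ?thesis by (simp add: sgn_deriv_def)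
next
  case False
  have "(x \<bullet> h)\<^sup>2 \<le> (norm x)\<^sup>2 * (norm h)\<^sup>2"
    using Cauchy_Schwarz_ineq[of x h] by (simp add: power2_norm_eq_inner)
  then have "(x \<bullet> h)\<^sup>2 / norm x ^ 3 \<le> (norm x)\<^sup>2 * (norm h)\<^sup>2 / norm x ^ 3"
    by (rule divide_right_mono) auto
  also have "\<dots> = (norm h)\<^sup>2 / norm x"
    using False by (simp add: field_simps power2_eq_square power3_eq_cube)
  finally have "(x \<bullet> h)\<^sup>2 / norm x ^ 3 \<le> (norm h)\<^sup>2 / norm x" .
  moreover have "sgn_deriv x h \<bullet> h = (norm h)\<^sup>2 / norm x - (x \<bullet> h)\<^sup>2 / norm x ^ 3"
    by (simp add: sgn_deriv_def inner_diff_left dot_square_norm divide_inverse mult.commute power2_eq_square)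
  ultimately show ?thesis by simp
qed

text \<open>Exchanging the two indices and averaging: an antisymmetric interaction only sees the
  differences of \<open>u\<close>, as with action and reaction.\<close>

lemma sum_antisym_inner:
  fixes A :: "'n \<Rightarrow> 'n \<Rightarrow> 'a::real_inner" and u :: "'n \<Rightarrow> 'a"
  assumes "\<And>i j. A j i = - A i j"
  shows "(\<Sum>i\<in>I. \<Sum>j\<in>I. A i j \<bullet> u i) = 1/2 * (\<Sum>i\<in>I. \<Sum>j\<in>I. A i j \<bullet> (u i - u j))"
proof -
  have "(\<Sum>i\<in>I. \<Sum>j\<in>I. A i j \<bullet> u j) = (\<Sum>i\<in>I. \<Sum>j\<in>I. A j i \<bullet> u i)"
    by (rule sum.swap)
  also have "\<dots> = - (\<Sum>i\<in>I. \<Sum>j\<in>I. A i j \<bullet> u i)"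
    by (subst assms) (simp add: sum_negf)
  finally show ?thesis by (simp add: inner_diff_right sum_subtractf)
qed

text \<open>The sum may run over all \<open>j\<close> because the diagonal term is
  \<open>sgn 0 = 0\<close>.\<close>

definition attraction :: "(real ^ 'd) ^ 'n \<Rightarrow> (real ^ 'd) ^ 'n" where
  "attraction q = (\<chi> i. \<Sum>j\<in>UNIV. sgn (q $ j - q $ i))"

text \<open>Stated through \<open>powr\<close> and the inner product, the form to which
  \<open>C2_on_powr\<close> applies; \<open>weight_sqrt\<close> gives the form used in
  estimates.\<close>

definition weight :: "real \<Rightarrow> 'a::real_inner \<Rightarrow> real" where
  "weight \<eta> q = (1 + \<eta> * (q \<bullet> q)) powr (-1/2)"

definition drift_field :: "real \<Rightarrow> real \<Rightarrow> (real ^ 'd) ^ 'n \<Rightarrow> (real ^ 'd) ^ 'n" where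
  "drift_field \<delta> \<eta> q = weight \<eta> q *\<^sub>R (\<delta> *\<^sub>R q + attraction q)"

lemma norm_attraction_component_le: "norm (attraction (q :: (real ^ 'd) ^ 'n) $ i) \<le> real CARD('n)"
proof -
  have "norm (attraction q $ i) \<le> (\<Sum>j\<in>(UNIV::'n set). norm (sgn (q $ j - q $ i)))"
    unfolding attraction_def vec_lambda_beta by (rule norm_sum)
  also have "\<dots> \<le> (\<Sum>j\<in>(UNIV::'n set). 1)"
    by (rule sum_mono) (simp add: norm_sgn)
  finally show ?thesis by simp
qed

lemma norm_attraction_le: "norm (attraction (q :: (real ^ 'd) ^ 'n)) \<le> (real CARD('n))\<^sup>2"
proof -
  have "(\<Sum>i\<in>UNIV. norm (attraction q $ i)) \<le> (\<Sum>i\<in>(UNIV::'n set). real CARD('n))"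
    by (intro sum_mono norm_attraction_component_le)
  moreover have "norm (attraction q) \<le> (\<Sum>i\<in>UNIV. norm (attraction q $ i))"
    unfolding norm_vec_def by (rule L2_set_le_sum) simp
  ultimately show ?thesis by (simp add: power2_eq_square)
qed

lemma weight_sqrt:
  assumes "\<eta> \<ge> 0"
  shows "weight \<eta> q = 1 / sqrt (1 + \<eta> * (norm q)\<^sup>2)"
proof -
  have "0 \<le> 1 + \<eta> * (q \<bullet> q)" using assms by simp
  then have "(1 + \<eta> * (q \<bullet> q)) powr (- (1/2)) = 1 / sqrt (1 + \<eta> * (q \<bullet> q))"
    by (simp only: powr_minus powr_half_sqrt inverse_eq_divide)
  then show ?thesis by (simp add: weight_def power2_norm_eq_inner)
qed

text \<open>The third bound is the decisive one: it caps the length of the weighted position by 1 /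
  sqrt \<eta>, which makes the linear part of the drift field bounded.\<close>

lemma weight_bounds:
  assumes "\<eta> > 0"
  shows "weight \<eta> q > 0" "weight \<eta> q \<le> 1" "weight \<eta> q * (sqrt \<eta> * norm q) \<le> 1"
proof -
  have "1 + \<eta> * (norm q)\<^sup>2 \<ge> 1" using assms by simp
  then have pos: "sqrt (1 + \<eta> * (norm q)\<^sup>2) \<ge> 1" by simp
  have w: "weight \<eta> q = 1 / sqrt (1 + \<eta> * (norm q)\<^sup>2)"
    using assms by (simp add: weight_sqrt)
  show "weight \<eta> q > 0" unfolding w using pos by (intro divide_pos_pos) linarith+
  show "weight \<eta> q \<le> 1" unfolding w using pos by (subst divide_le_eq_1_pos) linarith+
  have "sqrt \<eta> * norm q = sqrt (\<eta> * (norm q)\<^sup>2)" by (simp add: real_sqrt_mult)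
  also have "\<dots> \<le> sqrt (1 + \<eta> * (norm q)\<^sup>2)" by simp
  finally have "sqrt \<eta> * norm q / sqrt (1 + \<eta> * (norm q)\<^sup>2) \<le> 1"
    using pos by (subst divide_le_eq_1_pos) linarith+
  then show "weight \<eta> q * (sqrt \<eta> * norm q) \<le> 1" unfolding w by simp
qed

lemma weight_has_derivative:
  assumes "\<eta> \<ge> 0"
  shows "(weight \<eta> has_derivative (\<lambda>h. - \<eta> * weight \<eta> q ^ 3 * (q \<bullet> h))) (at q)"
proof -
  define t where "t = 1 + \<eta> * (q \<bullet> q)"
  have t: "t > 0" using assms by (simp add: t_def add_pos_nonneg)
  have "((\<lambda>t. t powr (-1/2)) has_real_derivative (-1/2) * t powr (-1/2 - 1)) (at t)"
    using t by (rule has_real_derivative_powr)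
  then have 1: "((\<lambda>t. t powr (-1/2)) has_derivative (\<lambda>h. (-1/2) * t powr (-1/2 - 1) * h)) (at t)"
    unfolding has_field_derivative_def .
  have 2: "((\<lambda>q. 1 + \<eta> * (q \<bullet> q)) has_derivative (\<lambda>h. 2 * \<eta> * (q \<bullet> h))) (at q)"
    by (auto intro!: derivative_eq_intros simp: inner_commute)
  \<comment> \<open>The exponent -3/2 is three times -1/2, so the derivative can be expressed by the
    weight itself.\<close>
  have "t powr (-1/2 - 1) = weight \<eta> q ^ 3"
    using t by (simp add: weight_def t_def[symmetric] powr_power)
  then have eq: "(\<lambda>h. (-1/2) * t powr (-1/2 - 1) * (2 * \<eta> * (q \<bullet> h))) = (\<lambda>h. - \<eta> * weight \<eta> q ^ 3 * (q \<bullet> h))"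
    by (simp add: mult_ac)
  have "weight \<eta> = (\<lambda>q. (1 + \<eta> * (q \<bullet> q)) powr (-1/2))"
    by (simp add: weight_def fun_eq_iff)
  then show ?thesis
    unfolding eq[symmetric] by (rule ssubst) (rule has_derivative_compose[OF 2 1[unfolded t_def], folded t_def])
qed

lemma norm_drift_field_le:
  fixes q :: "(real ^ 'd) ^ 'n"
  assumes "\<eta> > 0" "\<delta> \<ge> 0"
  shows "norm (drift_field \<delta> \<eta> q) \<le> \<delta> / sqrt \<eta> + (real CARD('n))\<^sup>2"
proof -
  note w = weight_bounds[OF assms(1), of q]
  have "norm (drift_field \<delta> \<eta> q) \<le> weight \<eta> q * (\<delta> * norm q + norm (attraction q))"
    unfolding drift_field_def using w(1) assms(2) norm_triangle_ineq[of "\<delta> *\<^sub>R q" "attraction q"]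
    by (simp add: mult_left_mono)
  also have "\<dots> = \<delta> / sqrt \<eta> * (weight \<eta> q * (sqrt \<eta> * norm q)) + weight \<eta> q * norm (attraction q)"
    using assms(1) by (simp add: algebra_simps)
  also have "\<dots> \<le> \<delta> / sqrt \<eta> * 1 + 1 * (real CARD('n))\<^sup>2"
    by (intro add_mono mult_mono) (use w assms norm_attraction_le[of q] in auto)
  finally show ?thesis by simp
qed

text \<open>Only an upper bound on the quadratic form is available: near collisions it has no lower
  bound, but the attraction enters with a nonpositive sign. The linear part costs \<delta>;
  differentiating the weight costs another \<delta> and the term with sqrt \<eta>.\<close>

lemma drift_field_derivative:
  fixes q p :: "(real ^ 'd) ^ 'n"
  assumes q: "q \<in> config_space" and \<eta>: "\<eta> > 0" and \<delta>: "\<delta> > 0"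
  obtains D where "((\<lambda>q. drift_field \<delta> \<eta> q \<bullet> p) has_derivative D) (at q)"
    and "D p \<le> (2 * \<delta> + sqrt \<eta> * (real CARD('n))\<^sup>2) * (norm p)\<^sup>2"
proof -
  let ?w = "weight \<eta> q"
  note w = weight_bounds[OF \<eta>, of q]
  have s: "((\<lambda>q. sgn (q $ j - q $ i) \<bullet> p $ i) has_derivative
      (\<lambda>h. sgn_deriv (q $ j - q $ i) (h $ j - h $ i) \<bullet> p $ i)) (at q)" for i j
  proof (cases "i = j")
    case True
    then show ?thesis by (simp add: sgn_deriv_def)
  next
    case False
    then have "q $ j - q $ i \<noteq> 0" using q by (auto simp: config_space_def)
    from sgn_has_derivative[OF this]
    have "(sgn has_derivative sgn_deriv (q $ j - q $ i)) (at (q $ j - q $ i))" .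
    moreover have "((\<lambda>q. q $ j - q $ i) has_derivative (\<lambda>h. h $ j - h $ i)) (at q)"
      by (intro bounded_linear_imp_has_derivative bounded_linear_intros bounded_linear_vec_nth)
    ultimately have "((\<lambda>q. sgn (q $ j - q $ i)) has_derivative (\<lambda>h. sgn_deriv (q $ j - q $ i) (h $ j - h $ i))) (at q)"
      using has_derivative_compose by blast
    then show ?thesis by (rule has_derivative_inner_left)
  qed
  define A where "A h = (\<Sum>i\<in>UNIV. \<Sum>j\<in>UNIV. sgn_deriv (q $ j - q $ i) (h $ j - h $ i) \<bullet> p $ i)" for h :: "(real ^ 'd) ^ 'n"
  have att: "attraction q \<bullet> p = (\<Sum>i\<in>UNIV. \<Sum>j\<in>UNIV. sgn (q $ j - q $ i) \<bullet> p $ i)" for q :: "(real ^ 'd) ^ 'n"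
    unfolding inner_vec_def[of "attraction q" p] by (simp add: attraction_def inner_sum_left)
  have dA: "((\<lambda>q. attraction q \<bullet> p) has_derivative A) (at q)"
    unfolding att A_def by (intro has_derivative_sum s)
  \<comment> \<open>\<open>sgn_deriv\<close> is even in its base point and odd in the direction, so
    the pair terms are antisymmetric. After symmetrization each one is minus a value of a positive
    semidefinite form.\<close>
  have "A p = 1/2 * (\<Sum>i\<in>UNIV. \<Sum>j\<in>UNIV. sgn_deriv (q $ j - q $ i) (p $ j - p $ i) \<bullet> (p $ i - p $ j))"
    unfolding A_def
  proof (rule sum_antisym_inner)
    fix i j
    show "sgn_deriv (q $ i - q $ j) (p $ i - p $ j) = - sgn_deriv (q $ j - q $ i) (p $ j - p $ i)"
      unfolding sgn_deriv_def norm_minus_commute[of "q $ i"]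
      by (simp add: inner_diff_left inner_diff_right algebra_simps)
  qed
  also have "(\<Sum>i\<in>UNIV. \<Sum>j\<in>UNIV. sgn_deriv (q $ j - q $ i) (p $ j - p $ i) \<bullet> (p $ i - p $ j)) \<le> 0"
  proof (intro sum_nonpos)
    fix i j
    show "sgn_deriv (q $ j - q $ i) (p $ j - p $ i) \<bullet> (p $ i - p $ j) \<le> 0"
      using inner_sgn_deriv_nonneg[of "q $ j - q $ i" "p $ j - p $ i"]
      by (simp add: inner_diff_right)
  qed
  finally have A: "A p \<le> 0" by simp
  define D where "D h = ?w * (\<delta> * (h \<bullet> p) + A h) + (- \<eta> * ?w ^ 3 * (q \<bullet> h)) * (\<delta> * (q \<bullet> p) + attraction q \<bullet> p)" for h
  have "((\<lambda>q. weight \<eta> q * (\<delta> * (q \<bullet> p) + attraction q \<bullet> p)) has_derivative D) (at q)"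
    unfolding D_def
    by (intro has_derivative_mult weight_has_derivative has_derivative_add dA
        has_derivative_mult_right has_derivative_inner_left has_derivative_ident less_imp_le[OF \<eta>])
  then have "((\<lambda>q. drift_field \<delta> \<eta> q \<bullet> p) has_derivative D) (at q)"
    by (simp add: drift_field_def inner_add_left)
  moreover have "D p \<le> (2 * \<delta> + sqrt \<eta> * (real CARD('n))\<^sup>2) * (norm p)\<^sup>2"
  proof -
    have "?w * (\<delta> * (p \<bullet> p) + A p) \<le> 1 * (\<delta> * (norm p)\<^sup>2)"
    proof -
      have "?w * (\<delta> * (p \<bullet> p)) \<le> 1 * (\<delta> * (p \<bullet> p))"
        using w \<delta> by (intro mult_right_mono) auto
      moreover have "?w * A p \<le> 0" using w A by (intro mult_nonneg_nonpos) auto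
      ultimately show ?thesis by (simp only: power2_norm_eq_inner distrib_left)
    qed
    moreover have "(- \<eta> * ?w ^ 3 * (q \<bullet> p)) * (\<delta> * (q \<bullet> p) + attraction q \<bullet> p)
        \<le> (\<delta> + sqrt \<eta> * (real CARD('n))\<^sup>2) * (norm p)\<^sup>2"
    proof -
      have 1: "?w * sqrt \<eta> * \<bar>q \<bullet> p\<bar> \<le> norm p"
      proof -
        have "?w * sqrt \<eta> * \<bar>q \<bullet> p\<bar> \<le> ?w * sqrt \<eta> * (norm q * norm p)"
          using w \<eta> by (intro mult_left_mono Cauchy_Schwarz_ineq2) auto
        also have "\<dots> = (?w * (sqrt \<eta> * norm q)) * norm p" by simp
        also have "\<dots> \<le> 1 * norm p" using w by (intro mult_right_mono) auto
        finally show ?thesis by simp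
      qed
      have 2: "?w * sqrt \<eta> * \<bar>\<delta> * (q \<bullet> p) + attraction q \<bullet> p\<bar> \<le> (\<delta> + sqrt \<eta> * (real CARD('n))\<^sup>2) * norm p"
      proof -
        have "\<bar>attraction q \<bullet> p\<bar> \<le> (real CARD('n))\<^sup>2 * norm p"
          using Cauchy_Schwarz_ineq2[of "attraction q" p]
            mult_right_mono[OF norm_attraction_le[of q], of "norm p"] by simp
        then have "?w * sqrt \<eta> * \<bar>attraction q \<bullet> p\<bar> \<le> 1 * sqrt \<eta> * ((real CARD('n))\<^sup>2 * norm p)"
          using w \<eta> by (intro mult_mono) auto
        moreover have "?w * sqrt \<eta> * \<bar>\<delta> * (q \<bullet> p)\<bar> \<le> \<delta> * norm p"
          using mult_left_mono[OF 1, of \<delta>] \<delta> by (simp add: abs_mult mult_ac)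
        moreover have "?w * sqrt \<eta> * \<bar>\<delta> * (q \<bullet> p) + attraction q \<bullet> p\<bar>
            \<le> ?w * sqrt \<eta> * (\<bar>\<delta> * (q \<bullet> p)\<bar> + \<bar>attraction q \<bullet> p\<bar>)"
          using w \<eta> by (intro mult_left_mono) auto
        ultimately show ?thesis by (simp add: algebra_simps)
      qed
      have "(- \<eta> * ?w ^ 3 * (q \<bullet> p)) * (\<delta> * (q \<bullet> p) + attraction q \<bullet> p)
        \<le> \<bar>(- \<eta> * ?w ^ 3 * (q \<bullet> p)) * (\<delta> * (q \<bullet> p) + attraction q \<bullet> p)\<bar>" by simp
      \<comment> \<open>The factor \<open>\<eta> * ?w ^ 3\<close> splits into one \<open>?w\<close>,
        at most 1, and two copies of \<open>?w * sqrt \<eta>\<close>, each of which compensates one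
        occurrence of \<open>q\<close>.\<close>
      also have "\<dots> = ?w * ((?w * sqrt \<eta> * \<bar>q \<bullet> p\<bar>) * (?w * sqrt \<eta> * \<bar>\<delta> * (q \<bullet> p) + attraction q \<bullet> p\<bar>))"
        using w \<eta> real_sqrt_mult_self[of \<eta>] by (simp add: abs_mult power3_eq_cube)
      also have "\<dots> \<le> 1 * (norm p * ((\<delta> + sqrt \<eta> * (real CARD('n))\<^sup>2) * norm p))"
        by (intro mult_mono 1 2) (use w \<eta> \<delta> in auto)
      finally show ?thesis by (simp add: power2_eq_square mult_ac)
    qed
    ultimately show ?thesis unfolding D_def by (simp add: algebra_simps)
  qed
  ultimately show thesis by (rule that)
qed

subsection \<open>Potential energy\<close>

definition kernel_factor :: "nat \<Rightarrow> real" where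
  "kernel_factor d = (if d = 2 then 1 else real d - 2)"

lemma inner_self_powr:
  assumes "x \<noteq> 0"
  shows "(x \<bullet> x) powr s = norm x powr (2 * s)"
proof -
  have "x \<bullet> x = norm x powr 2"
    using assms by (simp add: power2_norm_eq_inner)
  then show ?thesis by (simp only: powr_powr)
qed

text \<open>As a real function of the polynomial \<open>x \<bullet> x\<close> the kernel falls under
  the \<open>C2_on\<close> chain rules, and its derivative becomes a one-variable
  computation.\<close>

lemma coulomb_kernel_inner:
  fixes x :: "real ^ 'd"
  assumes "CARD('d) \<ge> 2" "x \<noteq> 0"
  shows "coulomb_kernel x = (if CARD('d) = 2 then - 1/2 * ln (x \<bullet> x) else (x \<bullet> x) powr (1 - real CARD('d) / 2))"
proof -
  have n: "norm x > 0" using assms by simp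
  have "norm x powi (2 - int CARD('d)) = norm x powr (2 - real CARD('d))"
    using powr_real_of_int'[of "norm x" "2 - int CARD('d)"] n by simp
  moreover have "ln (x \<bullet> x) = 2 * ln (norm x)"
    using n by (simp add: power2_norm_eq_inner[symmetric] ln_realpow)
  ultimately show ?thesis
    using inner_self_powr[OF assms(2)] by (simp add: coulomb_kernel_def algebra_simps)
qed

lemma C2_on_coulomb_kernel:
  assumes "CARD('d) \<ge> 2"
  shows "C2_on (coulomb_kernel :: real ^ 'd \<Rightarrow> real) (- {0})"
proof -
  have i: "C2_on (\<lambda>x :: real ^ 'd. x \<bullet> x) (- {0})"
    by (intro C2_on_inner bounded_linear_ident)
  have "C2_on (\<lambda>x :: real ^ 'd. if CARD('d) = 2 then - 1/2 * ln (x \<bullet> x)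
      else (x \<bullet> x) powr (1 - real CARD('d) / 2)) (- {0})"
  proof (cases "CARD('d) = 2")
    case True
    have "C2_on (\<lambda>x :: real ^ 'd. - 1/2 * ln (x \<bullet> x)) (- {0})"
      by (intro C2_on_mult C2_on_const C2_on_ln i) auto
    with True show ?thesis by simp
  next
    case False
    have "C2_on (\<lambda>x :: real ^ 'd. (x \<bullet> x) powr (1 - real CARD('d) / 2)) (- {0})"
      by (intro C2_on_powr i) auto
    with False show ?thesis by simp
  qed
  then show ?thesis
    by (rule C2_on_cong[rotated]) (use assms in \<open>auto simp: coulomb_kernel_inner\<close>)
qed

text \<open>The gradient is -\<kappa> x / |x|^d in every dimension d \<ge> 2, where \<kappa> is
  \<open>kernel_factor\<close>: 1 for the logarithm, d - 2 for the power.\<close>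

lemma coulomb_kernel_has_derivative:
  fixes x :: "real ^ 'd"
  assumes d: "CARD('d) \<ge> 2" and x: "x \<noteq> 0"
  shows "(coulomb_kernel has_derivative
    (\<lambda>h. - kernel_factor CARD('d) * norm x powr (- real CARD('d)) * (x \<bullet> h))) (at x)"
proof -
  define k where "k t = (if CARD('d) = 2 then - 1/2 * ln t else t powr (1 - real CARD('d) / 2))" for t :: real
  define k' where "k' t = - kernel_factor CARD('d) / 2 * t powr (- real CARD('d) / 2)" for t :: real
  have pos: "x \<bullet> x > 0" using x by simp
  have "(k has_real_derivative k' t) (at t)" if "t > 0" for t
  proof (cases "CARD('d) = 2")
    case True
    then have "k = (\<lambda>t. - 1/2 * ln t)" by (simp add: k_def fun_eq_iff)
    moreover have "k' t = - 1/2 * inverse t"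
      using True that by (simp add: k'_def kernel_factor_def powr_minus)
    ultimately show ?thesis using DERIV_cmult[OF DERIV_ln[OF that], of "- 1/2"] by simp
  next
    case False
    then have "k = (\<lambda>t. t powr (1 - real CARD('d) / 2))" by (simp add: k_def fun_eq_iff)
    moreover have "k' t = (1 - real CARD('d) / 2) * t powr (1 - real CARD('d) / 2 - 1)"
      using False by (simp add: k'_def kernel_factor_def field_simps)
    ultimately show ?thesis using has_real_derivative_powr[OF that, of "1 - real CARD('d) / 2"] by simp
  qed
  from this[OF pos] have k: "(k has_derivative (\<lambda>h. k' (x \<bullet> x) * h)) (at (x \<bullet> x))"
    unfolding has_field_derivative_def .
  have "((\<lambda>y. y \<bullet> y) has_derivative (\<lambda>h. 2 * (x \<bullet> h))) (at x)"
    by (auto intro!: derivative_eq_intros simp: inner_commute)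
  from has_derivative_compose[OF this k]
  have "((\<lambda>y. k (y \<bullet> y)) has_derivative (\<lambda>h. k' (x \<bullet> x) * (2 * (x \<bullet> h)))) (at x)" .
  moreover have "k' (x \<bullet> x) * (2 * (x \<bullet> h)) =
      - kernel_factor CARD('d) * norm x powr (- real CARD('d)) * (x \<bullet> h)" for h
    using inner_self_powr[OF x, of "- real CARD('d) / 2"] by (simp add: k'_def)
  ultimately have "((\<lambda>y. k (y \<bullet> y)) has_derivative
      (\<lambda>h. - kernel_factor CARD('d) * norm x powr (- real CARD('d)) * (x \<bullet> h))) (at x)"
    by simp
  then show ?thesis
    by (rule has_derivative_transform_within_open[of _ _ _ _ "- {0}"])
       (use x d in \<open>auto simp: coulomb_kernel_inner k_def\<close>)
qed

text \<open>The derivative of the potential energy at \<open>q\<close> in direction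
  \<open>h\<close>. The interaction is kept in terms of the differences of \<open>h\<close>, so that
  the effect of a drift field can be estimated pair by pair.\<close>

definition force_pairing ::
  "(real ^ 'd \<Rightarrow> real) \<Rightarrow> (real ^ 'd) ^ 'n \<Rightarrow> (real ^ 'd) ^ 'n \<Rightarrow> real" where
  "force_pairing V q h = (\<Sum>i\<in>UNIV. grad V (q $ i) \<bullet> h $ i) +
    1 / (2 * real CARD('n)) * (\<Sum>i\<in>UNIV. \<Sum>j\<in>UNIV - {i}.
      - kernel_factor CARD('d) * norm (q $ i - q $ j) powr (- real CARD('d)) *
      ((q $ i - q $ j) \<bullet> (h $ i - h $ j)))"

lemma C2_on_has_derivative_grad:
  fixes V :: "'a::euclidean_space \<Rightarrow> real"
  assumes "C2_on V S" "x \<in> S"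
  shows "(V has_derivative (\<lambda>h. grad V x \<bullet> h)) (at x)"
proof -
  obtain D where D: "(V has_derivative blinfun_apply D) (at x)"
    using assms unfolding C2_on_def by blast
  show ?thesis
    by (rule has_derivative_eq_rhs[OF D]) (auto simp: grad_inner[OF D])
qed

lemma potential_energy_has_derivative:
  fixes V :: "real ^ 'd \<Rightarrow> real" and q :: "(real ^ 'd) ^ 'n"
  assumes d: "CARD('d) \<ge> 2" and V: "C2_on V UNIV" and q: "q \<in> config_space"
  shows "(potential_energy V has_derivative force_pairing V q) (at q)"
proof -
  have 1: "((\<lambda>q. V (q $ i)) has_derivative (\<lambda>h. grad V (q $ i) \<bullet> h $ i)) (at q)" for i
    by (rule has_derivative_compose[OF bounded_linear_imp_has_derivative[OF bounded_linear_vec_nth]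
          C2_on_has_derivative_grad[OF V]]) simp
  have 2: "((\<lambda>q. coulomb_kernel (q $ i - q $ j)) has_derivative
      (\<lambda>h. - kernel_factor CARD('d) * norm (q $ i - q $ j) powr (- real CARD('d)) *
      ((q $ i - q $ j) \<bullet> (h $ i - h $ j)))) (at q)" if "j \<in> UNIV - {i}" for i j
  proof -
    have "q $ i - q $ j \<noteq> 0" using q that by (auto simp: config_space_def)
    moreover have "((\<lambda>q. q $ i - q $ j) has_derivative (\<lambda>h. h $ i - h $ j)) (at q)"
      by (intro bounded_linear_imp_has_derivative bounded_linear_intros bounded_linear_vec_nth)
    ultimately show ?thesis
      using has_derivative_compose[OF _ coulomb_kernel_has_derivative[OF d]] by blast
  qed
  have "((\<lambda>q. (\<Sum>i\<in>UNIV. V (q $ i)) + 1 / (2 * real CARD('n)) *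
      (\<Sum>i\<in>UNIV. \<Sum>j\<in>UNIV - {i}. coulomb_kernel (q $ i - q $ j))) has_derivative force_pairing V q) (at q)"
    unfolding force_pairing_def[abs_def]
    by (intro has_derivative_add has_derivative_sum has_derivative_mult_right 1 2)
  moreover have "potential_energy V = (\<lambda>q :: (real ^ 'd) ^ 'n. (\<Sum>i\<in>UNIV. V (q $ i)) + 1 / (2 * real CARD('n)) *
      (\<Sum>i\<in>UNIV. \<Sum>j\<in>UNIV - {i}. coulomb_kernel (q $ i - q $ j)))"
    by (simp add: potential_energy_def fun_eq_iff)
  ultimately show ?thesis by simp
qed

section \<open>Smoothness of the exponent on the phase space\<close>

lemma C2_on_hamiltonian:
  fixes V :: "real ^ 'd \<Rightarrow> real"
  assumes d: "CARD('d) \<ge> 2" and V: "C2_on V UNIV"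
  shows "C2_on (hamiltonian V :: ((real ^ 'd) ^ 'n) \<times> ((real ^ 'd) ^ 'n) \<Rightarrow> real) phase_space"
proof -
  have nth: "bounded_linear (\<lambda>x :: ((real ^ 'd) ^ 'n) \<times> ((real ^ 'd) ^ 'n). fst x $ i)" for i
    using bounded_linear_compose[OF bounded_linear_vec_nth bounded_linear_fst] .
  have K: "C2_on (\<lambda>x :: ((real ^ 'd) ^ 'n) \<times> ((real ^ 'd) ^ 'n). coulomb_kernel (fst x $ i - fst x $ j)) phase_space"
    if "j \<in> UNIV - {i}" for i j
    by (rule C2_on_compose_bounded_linear[OF bounded_linear_sub[OF nth nth] C2_on_coulomb_kernel[OF d]])
       (use that in \<open>auto simp: phase_space_def config_space_def\<close>)
  have "C2_on (\<lambda>x :: ((real ^ 'd) ^ 'n) \<times> ((real ^ 'd) ^ 'n). 1/2 * (snd x \<bullet> snd x) +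
      ((\<Sum>i\<in>UNIV. V (fst x $ i)) + 1 / (2 * real CARD('n)) *
      (\<Sum>i\<in>UNIV. \<Sum>j\<in>UNIV - {i}. coulomb_kernel (fst x $ i - fst x $ j)))) phase_space"
    by (intro C2_on_add C2_on_mult C2_on_const C2_on_sum C2_on_inner bounded_linear_snd K
        C2_on_compose_bounded_linear[OF nth V]) auto
  moreover have "hamiltonian V = (\<lambda>x :: ((real ^ 'd) ^ 'n) \<times> ((real ^ 'd) ^ 'n). 1/2 * (snd x \<bullet> snd x) +
      ((\<Sum>i\<in>UNIV. V (fst x $ i)) + 1 / (2 * real CARD('n)) *
      (\<Sum>i\<in>UNIV. \<Sum>j\<in>UNIV - {i}. coulomb_kernel (fst x $ i - fst x $ j))))"
    by (simp add: hamiltonian_def potential_energy_def fun_eq_iff power2_norm_eq_inner)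
  ultimately show ?thesis by simp
qed

lemma C2_on_drift_field:
  assumes "\<eta> > 0"
  shows "C2_on (\<lambda>x :: ((real ^ 'd) ^ 'n) \<times> ((real ^ 'd) ^ 'n). drift_field \<delta> \<eta> (fst x) \<bullet> snd x) phase_space"
proof -
  have fnth: "bounded_linear (\<lambda>x :: ((real ^ 'd) ^ 'n) \<times> ((real ^ 'd) ^ 'n). fst x $ i)" for i
    using bounded_linear_compose[OF bounded_linear_vec_nth bounded_linear_fst] .
  have snth: "bounded_linear (\<lambda>x :: ((real ^ 'd) ^ 'n) \<times> ((real ^ 'd) ^ 'n). snd x $ i)" for i
    using bounded_linear_compose[OF bounded_linear_vec_nth bounded_linear_snd] .
  have diff: "bounded_linear (\<lambda>x :: ((real ^ 'd) ^ 'n) \<times> ((real ^ 'd) ^ 'n). fst x $ j - fst x $ i)" for i j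
    by (rule bounded_linear_sub[OF fnth fnth])
  have s: "C2_on (\<lambda>x :: ((real ^ 'd) ^ 'n) \<times> ((real ^ 'd) ^ 'n). sgn (fst x $ j - fst x $ i) \<bullet> snd x $ i) phase_space" for i j
  proof (cases "i = j")
    case True
    then show ?thesis by (simp add: C2_on_const)
  next
    case False
    have "C2_on (\<lambda>x :: ((real ^ 'd) ^ 'n) \<times> ((real ^ 'd) ^ 'n).
       ((fst x $ j - fst x $ i) \<bullet> (fst x $ j - fst x $ i)) powr (-1/2) *
       ((fst x $ j - fst x $ i) \<bullet> snd x $ i)) phase_space"
      by (intro C2_on_mult C2_on_powr C2_on_inner diff snth)
         (use False in \<open>auto simp: phase_space_def config_space_def\<close>)
    moreover have "(y \<bullet> y) powr (-1/2) * (y \<bullet> z) = sgn y \<bullet> z" for y z :: "real ^ 'd"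
    proof -
      have "(y \<bullet> y) powr (- (1/2)) = inverse (norm y)"
        by (simp only: powr_minus powr_half_sqrt inner_ge_zero norm_eq_sqrt_inner)
      then show ?thesis by (simp add: sgn_div_norm)
    qed
    ultimately show ?thesis by simp
  qed
  have "drift_field \<delta> \<eta> (fst x) \<bullet> snd x = (1 + \<eta> * (fst x \<bullet> fst x)) powr (-1/2) *
     (\<delta> * (fst x \<bullet> snd x) + (\<Sum>i\<in>UNIV. \<Sum>j\<in>UNIV. sgn (fst x $ j - fst x $ i) \<bullet> snd x $ i))"
    for x :: "((real ^ 'd) ^ 'n) \<times> ((real ^ 'd) ^ 'n)"
    unfolding drift_field_def weight_def inner_add_left inner_scaleR_left
      inner_vec_def[of "attraction (fst x)" "snd x"]
    by (simp add: attraction_def inner_sum_left)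
  moreover have "C2_on (\<lambda>x :: ((real ^ 'd) ^ 'n) \<times> ((real ^ 'd) ^ 'n). (1 + \<eta> * (fst x \<bullet> fst x)) powr (-1/2) *
     (\<delta> * (fst x \<bullet> snd x) + (\<Sum>i\<in>UNIV. \<Sum>j\<in>UNIV. sgn (fst x $ j - fst x $ i) \<bullet> snd x $ i))) phase_space"
    by (intro C2_on_mult C2_on_powr C2_on_add C2_on_sum C2_on_const C2_on_inner
        bounded_linear_fst bounded_linear_snd s)
       (use assms in \<open>auto intro: add_pos_nonneg\<close>)
  ultimately show ?thesis by simp
qed

text \<open>A nonnegative stand-in for the potential energy. Its pair terms have the size of the
  Coulomb force, |x|^(1-d), rather than of the kernel, because this is what unit-length attraction
  extracts from the force.\<close>

definition energy_scale :: "(real ^ 'd \<Rightarrow> real) \<Rightarrow> (real ^ 'd) ^ 'n \<Rightarrow> real" where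
  "energy_scale V q = (\<Sum>i\<in>UNIV. V (q $ i)) +
    (\<Sum>i\<in>UNIV. \<Sum>j\<in>UNIV - {i}. norm (q $ i - q $ j) powr (1 - real CARD('d)))"

lemma energy_scale_nonneg:
  assumes "\<And>x. V x \<ge> 0"
  shows "energy_scale V q \<ge> 0"
  unfolding energy_scale_def using assms by (intro add_nonneg_nonneg sum_nonneg) auto

section \<open>Comparison of the potential energy with the energy scale\<close>

lemma powr_le_one_plus_powr:
  fixes r s :: real
  assumes "r > 0" "s \<ge> 1"
  shows "r powr (1 - s) \<le> 1 + r powr (- s)"
proof (cases "r \<le> 1")
  case True
  then have "r powr (1 - s) \<le> r powr (- s)"
    using assms by (intro powr_mono') auto
  then show ?thesis by simp
next
  case False
  then have "r powr (1 - s) \<le> r powr 0"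
    using assms by (intro powr_mono) auto
  then have "r powr (1 - s) \<le> 1" using assms by simp
  then show ?thesis using powr_ge_zero[of r "- s"] by linarith
qed

text \<open>In dimension 2 both bounds are \<open>ln t \<le> t - 1\<close>, at the inverse of the
  norm and at the norm. In higher dimension the kernel is nonnegative and lies below 1 plus the
  force size.\<close>

lemma coulomb_kernel_bounds:
  fixes x :: "real ^ 'd"
  assumes d: "CARD('d) \<ge> 2" and x: "x \<noteq> 0"
  shows "coulomb_kernel x \<le> 1 + norm x powr (1 - real CARD('d))" "- norm x \<le> coulomb_kernel x"
proof -
  have n: "norm x > 0" using x by simp
  have "coulomb_kernel x \<le> 1 + norm x powr (1 - real CARD('d)) \<and> - norm x \<le> coulomb_kernel x"
  proof (cases "CARD('d) = 2")
    case True
    have "ln (inverse (norm x)) \<le> inverse (norm x) - 1"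
      using n by (intro ln_le_minus_one) simp
    moreover have "norm x powr (-1) = inverse (norm x)"
      using n by (simp add: powr_minus)
    ultimately show ?thesis
      using True n ln_le_minus_one[OF n] by (simp add: coulomb_kernel_def ln_inverse)
  next
    case False
    have "norm x powi (2 - int CARD('d)) = norm x powr (2 - real CARD('d))"
      using powr_real_of_int'[of "norm x" "2 - int CARD('d)"] n by simp
    moreover have "norm x powr (2 - real CARD('d)) \<le> 1 + norm x powr (1 - real CARD('d))"
      using powr_le_one_plus_powr[OF n, of "real CARD('d) - 1"] d by simp
    moreover have "norm x powr (2 - real CARD('d)) \<ge> - norm x"
      using n by (intro order_trans[OF _ powr_ge_zero]) simp
    ultimately show ?thesis using False by (simp add: coulomb_kernel_def)
  qed
  then show "coulomb_kernel x \<le> 1 + norm x powr (1 - real CARD('d))" "- norm x \<le> coulomb_kernel x"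
    by auto
qed

text \<open>This turns a bound on \<open>energy_scale\<close> into a bound on the Hamiltonian, hence
  on the Lyapunov function.\<close>

lemma potential_energy_le_energy_scale:
  fixes V :: "real ^ 'd \<Rightarrow> real" and q :: "(real ^ 'd) ^ 'n"
  assumes d: "CARD('d) \<ge> 2" and q: "q \<in> config_space"
  shows "potential_energy V q \<le> energy_scale V q + real CARD('n)"
proof -
  let ?N = "real CARD('n)"
  define R where "R = (\<Sum>i\<in>UNIV. \<Sum>j\<in>UNIV - {i}. norm (q $ i - q $ j) powr (1 - real CARD('d)))"
  have N: "?N \<ge> 1" using zero_less_card_finite[where 'a='n] by (simp add: Suc_leI)
  have R: "R \<ge> 0" unfolding R_def by (intro sum_nonneg) auto
  have "(\<Sum>i\<in>UNIV. \<Sum>j\<in>UNIV - {i}. coulomb_kernel (q $ i - q $ j))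
      \<le> (\<Sum>i\<in>UNIV. \<Sum>j\<in>UNIV - {i}. 1 + norm (q $ i - q $ j) powr (1 - real CARD('d)))"
    using q by (intro sum_mono coulomb_kernel_bounds(1)[OF d]) (auto simp: config_space_def)
  also have "\<dots> = (\<Sum>i\<in>(UNIV :: 'n set). real (card (UNIV - {i}))) + R"
    by (simp add: R_def sum.distrib)
  also have "(\<Sum>i\<in>(UNIV :: 'n set). real (card (UNIV - {i}))) \<le> (\<Sum>i\<in>(UNIV :: 'n set). ?N)"
    by (intro sum_mono) (simp add: card_mono)
  finally have "(\<Sum>i\<in>UNIV. \<Sum>j\<in>UNIV - {i}. coulomb_kernel (q $ i - q $ j)) \<le> ?N * ?N + R"
    by simp
  then have "1 / (2 * ?N) * (\<Sum>i\<in>UNIV. \<Sum>j\<in>UNIV - {i}. coulomb_kernel (q $ i - q $ j))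
      \<le> 1 / (2 * ?N) * (?N * ?N + R)"
    by (intro mult_left_mono) auto
  also have "\<dots> = ?N / 2 + R / (2 * ?N)" using N by (simp add: field_simps)
  also have "\<dots> \<le> ?N + R"
  proof -
    have "R / (2 * ?N) \<le> R / 1" using R N by (intro divide_left_mono) linarith+
    then show ?thesis using N by simp
  qed
  finally show ?thesis
    unfolding potential_energy_def energy_scale_def R_def by simp
qed

text \<open>The logarithmic kernel may be negative at large distance, but no worse than linearly.
  With the factor 1 / (2N) the pairs cost at most the sum of the norms of the positions, which the
  quadratic growth of \<open>V\<close> absorbs; 1 / (4c) comes from completing the square.\<close>

lemma potential_energy_bounded_below:
  fixes V :: "real ^ 'd \<Rightarrow> real"
  assumes d: "CARD('d) \<ge> 2" and c: "c > 0" and V: "\<And>x. V x \<ge> c * (norm x)\<^sup>2 - M"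
    and q: "(q :: (real ^ 'd) ^ 'n) \<in> config_space"
  shows "potential_energy V q \<ge> - (real CARD('n) * (M + 1 / (4 * c)))"
proof -
  let ?N = "real CARD('n)"
  have N: "?N \<ge> 1" using zero_less_card_finite[where 'a='n] by (simp add: Suc_leI)
  have "(\<Sum>i\<in>UNIV. \<Sum>j\<in>UNIV - {i}. coulomb_kernel (q $ i - q $ j))
      \<ge> (\<Sum>i\<in>UNIV. \<Sum>j\<in>UNIV - {i}. - (norm (q $ i) + norm (q $ j)))"
  proof (intro sum_mono)
    fix i j :: 'n assume "j \<in> UNIV - {i}"
    then have "q $ i - q $ j \<noteq> 0" using q by (auto simp: config_space_def)
    from coulomb_kernel_bounds(2)[OF d this] norm_triangle_ineq4[of "q $ i" "q $ j"]
    show "- (norm (q $ i) + norm (q $ j)) \<le> coulomb_kernel (q $ i - q $ j)" by linarith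
  qed
  moreover have "(\<Sum>i\<in>UNIV. \<Sum>j\<in>UNIV - {i}. norm (q $ i) + norm (q $ j))
      \<le> (\<Sum>i\<in>UNIV. \<Sum>j\<in>UNIV. norm (q $ i) + norm (q $ j))"
    by (intro sum_mono sum_mono2) auto
  moreover have "(\<Sum>i\<in>(UNIV :: 'n set). \<Sum>j\<in>(UNIV :: 'n set). norm (q $ i) + norm (q $ j))
      = 2 * ?N * (\<Sum>i\<in>UNIV. norm (q $ i))"
    by (simp add: sum.distrib sum_distrib_left[symmetric] mult.assoc)
  ultimately have "(\<Sum>i\<in>UNIV. \<Sum>j\<in>UNIV - {i}. coulomb_kernel (q $ i - q $ j))
      \<ge> - (2 * ?N * (\<Sum>i\<in>UNIV. norm (q $ i)))"
    by (simp only: sum_negf)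
  then have "1 / (2 * ?N) * (\<Sum>i\<in>UNIV. \<Sum>j\<in>UNIV - {i}. coulomb_kernel (q $ i - q $ j))
      \<ge> 1 / (2 * ?N) * - (2 * ?N * (\<Sum>i\<in>UNIV. norm (q $ i)))"
    by (intro mult_left_mono) auto
  also have "1 / (2 * ?N) * - (2 * ?N * (\<Sum>i\<in>UNIV. norm (q $ i))) = - (\<Sum>i\<in>UNIV. norm (q $ i))"
    using N by simp
  finally have "potential_energy V q \<ge> (\<Sum>i\<in>UNIV. V (q $ i) - norm (q $ i))"
    unfolding potential_energy_def by (simp add: sum_subtractf)
  moreover have "(\<Sum>i\<in>UNIV. V (q $ i) - norm (q $ i)) \<ge> (\<Sum>i\<in>(UNIV :: 'n set). - (M + 1 / (4 * c)))"
  proof (rule sum_mono)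
    fix i
    have "0 \<le> c * (norm (q $ i) - 1 / (2 * c))\<^sup>2" using c by simp
    also have "\<dots> = c * (norm (q $ i))\<^sup>2 - norm (q $ i) + 1 / (4 * c)"
      using c by (simp add: power2_eq_square field_simps)
    finally show "- (M + 1 / (4 * c)) \<le> V (q $ i) - norm (q $ i)" using V[of "q $ i"] by simp
  qed
  ultimately show ?thesis by (simp add: algebra_simps)
qed

text \<open>By monotonicity of \<open>sgn\<close> every particle \<open>k\<close> contributes a
  nonpositive amount. The term \<open>k = j\<close> alone gives the bound, and all others are
  discarded.\<close>

lemma inner_attraction_diff_le:
  fixes q :: "(real ^ 'd) ^ 'n"
  shows "(q $ i - q $ j) \<bullet> (attraction q $ i - attraction q $ j) \<le> - norm (q $ i - q $ j)"
proof -
  define f where "f k = (q $ i - q $ j) \<bullet> (sgn (q $ k - q $ i) - sgn (q $ k - q $ j))" for k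
  have f: "f k \<le> 0" for k
    using sgn_monotone[of "q $ k - q $ i" "q $ k - q $ j"]
    by (simp add: f_def inner_diff_left)
  have "f j = - ((q $ i - q $ j) \<bullet> sgn (q $ i - q $ j))"
    using sgn_minus[of "q $ i - q $ j"] by (simp add: f_def)
  then have fj: "f j = - norm (q $ i - q $ j)" by (simp add: inner_self_sgn)
  have "(q $ i - q $ j) \<bullet> (attraction q $ i - attraction q $ j) = (\<Sum>k\<in>UNIV. f k)"
    by (simp add: attraction_def f_def sum_subtractf[symmetric] inner_sum_right)
  also have "\<dots> = f j + (\<Sum>k\<in>UNIV - {j}. f k)" by (rule sum.remove) auto
  also have "\<dots> \<le> f j" using f by (simp add: sum_nonpos)
  finally show ?thesis using fj by simp
qed

text \<open>Each part of the field gains where the other one loses. The linear part gains from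
  confinement and the attraction gains from collisions; the smallness in \<open>gV\<close> and
  \<open>\<delta> \<le> 1/2\<close> let half of each gain survive.\<close>

lemma force_pairing_drift_field_ge:
  fixes V :: "real ^ 'd \<Rightarrow> real" and q :: "(real ^ 'd) ^ 'n"
  assumes d: "CARD('d) \<ge> 2"
    and \<delta>: "0 < \<delta>" "\<delta> \<le> 1/2" and \<eta>: "\<eta> > 0"
    and V: "\<And>x. c * V x - M \<le> grad V x \<bullet> x"
    and gV: "\<And>x. norm (grad V x) \<le> \<delta> * c / (2 * real CARD('n)) * V x + M'"
    and q: "q \<in> config_space"
  shows "force_pairing V q (drift_field \<delta> \<eta> q) \<ge> weight \<eta> q *
    (\<delta> * c / 2 * (\<Sum>i\<in>UNIV. V (q $ i)) +
     kernel_factor CARD('d) / (4 * real CARD('n)) *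
       (\<Sum>i\<in>UNIV. \<Sum>j\<in>UNIV - {i}. norm (q $ i - q $ j) powr (1 - real CARD('d))) -
     real CARD('n) * (\<delta> * M + real CARD('n) * M' + kernel_factor CARD('d)))"
proof -
  let ?N = "real CARD('n)" and ?\<kappa> = "kernel_factor CARD('d)" and ?w = "weight \<eta> q"
  let ?F = "drift_field \<delta> \<eta> q"
  note w = weight_bounds[OF \<eta>, of q]
  have N: "?N \<ge> 1" using zero_less_card_finite[where 'a='n] by (simp add: Suc_leI)
  have \<kappa>: "?\<kappa> > 0" using d by (simp add: kernel_factor_def)
  have "(\<Sum>i\<in>UNIV. grad V (q $ i) \<bullet> ?F $ i) \<ge>
      (\<Sum>i\<in>UNIV. ?w * (\<delta> * c / 2 * V (q $ i) - (\<delta> * M + ?N * M')))"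
  proof (rule sum_mono)
    fix i
    have "- (grad V (q $ i) \<bullet> attraction q $ i) \<le> norm (grad V (q $ i)) * norm (attraction q $ i)"
      using Cauchy_Schwarz_ineq2[of "grad V (q $ i)" "attraction q $ i"] by linarith
    \<comment> \<open>The attraction on one particle has length at most N, so the coefficient in
      \<open>gV\<close> makes this loss exactly half of the gain from the linear part, up to a
      constant.\<close>
    also have "\<dots> \<le> (\<delta> * c / (2 * ?N) * V (q $ i) + M') * ?N"
      by (intro mult_mono gV norm_attraction_component_le order_trans[OF norm_ge_zero gV] norm_ge_zero)
    also have "\<dots> = \<delta> * c / 2 * V (q $ i) + ?N * M'"
      using N by (simp add: field_simps)
    finally have "grad V (q $ i) \<bullet> attraction q $ i \<ge> - (\<delta> * c / 2 * V (q $ i) + ?N * M')" by linarith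
    moreover have "\<delta> * (grad V (q $ i) \<bullet> q $ i) \<ge> \<delta> * (c * V (q $ i) - M)"
      using V \<delta> by (intro mult_left_mono) auto
    ultimately have "\<delta> * c / 2 * V (q $ i) - (\<delta> * M + ?N * M') \<le>
        \<delta> * (grad V (q $ i) \<bullet> q $ i) + grad V (q $ i) \<bullet> attraction q $ i"
      by (simp add: algebra_simps)
    then have "?w * (\<delta> * c / 2 * V (q $ i) - (\<delta> * M + ?N * M')) \<le>
        ?w * (\<delta> * (grad V (q $ i) \<bullet> q $ i) + grad V (q $ i) \<bullet> attraction q $ i)"
      using w by (intro mult_left_mono) auto
    then show "?w * (\<delta> * c / 2 * V (q $ i) - (\<delta> * M + ?N * M')) \<le> grad V (q $ i) \<bullet> ?F $ i"
      by (simp add: drift_field_def inner_add_right algebra_simps)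
  qed
  also have "(\<Sum>i\<in>UNIV. ?w * (\<delta> * c / 2 * V (q $ i) - (\<delta> * M + ?N * M')))
      = ?w * (\<delta> * c / 2 * (\<Sum>i\<in>UNIV. V (q $ i)) - ?N * (\<delta> * M + ?N * M'))"
    by (simp only: sum_distrib_left[symmetric] sum_subtractf) simp
  finally have conf: "(\<Sum>i\<in>UNIV. grad V (q $ i) \<bullet> ?F $ i) \<ge>
      ?w * (\<delta> * c / 2 * (\<Sum>i\<in>UNIV. V (q $ i)) - ?N * (\<delta> * M + ?N * M'))" .
  define R where "R = (\<Sum>i\<in>UNIV. \<Sum>j\<in>UNIV - {i}. norm (q $ i - q $ j) powr (1 - real CARD('d)))"
  have "(\<Sum>i\<in>UNIV. \<Sum>j\<in>UNIV - {i}. - ?\<kappa> * norm (q $ i - q $ j) powr (- real CARD('d)) *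
      ((q $ i - q $ j) \<bullet> (?F $ i - ?F $ j))) \<ge>
      (\<Sum>i\<in>UNIV. \<Sum>j\<in>UNIV - {i}. ?w * ?\<kappa> / 2 * (norm (q $ i - q $ j) powr (1 - real CARD('d)) - 1))"
  proof (intro sum_mono)
    fix i j :: 'n assume "j \<in> UNIV - {i}"
    then have x: "norm (q $ i - q $ j) > 0" using q by (auto simp: config_space_def)
    let ?x = "q $ i - q $ j" and ?r = "norm (q $ i - q $ j)"
    have p1: "?r powr (- real CARD('d)) * ?r = ?r powr (1 - real CARD('d))"
      using x powr_add[of ?r "- real CARD('d)" 1] by (simp add: algebra_simps)
    have p2: "?r powr (1 - real CARD('d)) * ?r = ?r powr (2 - real CARD('d))"
      using x powr_add[of ?r "1 - real CARD('d)" 1] by (simp add: algebra_simps)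
    have p3: "?r powr (2 - real CARD('d)) \<le> 1 + ?r powr (1 - real CARD('d))"
      using powr_le_one_plus_powr[OF x, of "real CARD('d) - 1"] d by simp
    have "?x \<bullet> (?F $ i - ?F $ j) = ?w * (\<delta> * ?r\<^sup>2 + ?x \<bullet> (attraction q $ i - attraction q $ j))"
      unfolding power2_norm_eq_inner
      by (simp add: drift_field_def inner_add_right inner_diff_right algebra_simps)
    also have "\<dots> \<le> ?w * (\<delta> * ?r\<^sup>2 + - ?r)"
      using w by (intro mult_left_mono add_left_mono inner_attraction_diff_le) auto
    finally have "?\<kappa> * ?r powr (- real CARD('d)) * (?x \<bullet> (?F $ i - ?F $ j))
        \<le> ?\<kappa> * ?r powr (- real CARD('d)) * (?w * (\<delta> * ?r\<^sup>2 + - ?r))"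
      using \<kappa> by (intro mult_left_mono) auto
    also have "\<dots> = ?w * ?\<kappa> * (\<delta> * ((?r powr (- real CARD('d)) * ?r) * ?r) - ?r powr (- real CARD('d)) * ?r)"
      by (simp add: algebra_simps power2_eq_square)
    also have "\<dots> = ?w * ?\<kappa> * (\<delta> * ?r powr (2 - real CARD('d)) - ?r powr (1 - real CARD('d)))"
      unfolding p1 p2 ..
    \<comment> \<open>The repulsive effect of the linear part, of order r^(2-d), is absorbed through
      \<open>p3\<close> into half of the attraction gain r^(1-d) and a constant.\<close>
    also have "\<dots> \<le> ?w * ?\<kappa> * (1/2 * (1 + ?r powr (1 - real CARD('d))) - ?r powr (1 - real CARD('d)))"
      using w \<kappa> \<delta> by (intro mult_left_mono diff_right_mono mult_mono p3) auto
    finally show "?w * ?\<kappa> / 2 * (?r powr (1 - real CARD('d)) - 1) \<le>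
        - ?\<kappa> * ?r powr (- real CARD('d)) * (?x \<bullet> (?F $ i - ?F $ j))"
      by (simp add: algebra_simps)
  qed
  also have "(\<Sum>i\<in>UNIV. \<Sum>j\<in>UNIV - {i}. ?w * ?\<kappa> / 2 * (norm (q $ i - q $ j) powr (1 - real CARD('d)) - 1))
      = ?w * ?\<kappa> / 2 * (R - (\<Sum>i\<in>(UNIV :: 'n set). real (card (UNIV - {i}))))"
    by (simp only: sum_distrib_left[symmetric] sum_subtractf R_def) simp
  finally have "?w * ?\<kappa> / 2 * (R - ?N * ?N) \<le>
     (\<Sum>i\<in>UNIV. \<Sum>j\<in>UNIV - {i}. - ?\<kappa> * norm (q $ i - q $ j) powr (- real CARD('d)) *
      ((q $ i - q $ j) \<bullet> (?F $ i - ?F $ j)))"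
  proof (rule order_trans[rotated])
    have "(\<Sum>i\<in>(UNIV :: 'n set). real (card (UNIV - {i}))) \<le> (\<Sum>i\<in>(UNIV :: 'n set). ?N)"
      by (intro sum_mono) (simp add: card_mono)
    then show "?w * ?\<kappa> / 2 * (R - ?N * ?N) \<le> ?w * ?\<kappa> / 2 * (R - (\<Sum>i\<in>(UNIV :: 'n set). real (card (UNIV - {i}))))"
      using w \<kappa> by (intro mult_left_mono) auto
  qed
  then have "1 / (2 * ?N) * (?w * ?\<kappa> / 2 * (R - ?N * ?N)) \<le> 1 / (2 * ?N) *
     (\<Sum>i\<in>UNIV. \<Sum>j\<in>UNIV - {i}. - ?\<kappa> * norm (q $ i - q $ j) powr (- real CARD('d)) *
      ((q $ i - q $ j) \<bullet> (?F $ i - ?F $ j)))"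
    by (intro mult_left_mono) auto
  moreover have "1 / (2 * ?N) * (?w * ?\<kappa> / 2 * (R - ?N * ?N)) = ?w * (?\<kappa> / (4 * ?N) * R - ?N * ?\<kappa> / 4)"
    using N by (simp add: field_simps)
  moreover have "?w * (?\<kappa> / (4 * ?N) * R - ?N * ?\<kappa> / 4) \<ge> ?w * (?\<kappa> / (4 * ?N) * R - ?N * ?\<kappa>)"
    using w \<kappa> N by (intro mult_left_mono) auto
  ultimately have "?w * (?\<kappa> / (4 * ?N) * R - ?N * ?\<kappa>) \<le> 1 / (2 * ?N) *
     (\<Sum>i\<in>UNIV. \<Sum>j\<in>UNIV - {i}. - ?\<kappa> * norm (q $ i - q $ j) powr (- real CARD('d)) *
      ((q $ i - q $ j) \<bullet> (?F $ i - ?F $ j)))" by linarith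
  from add_mono[OF conf this]
  have "?w * (\<delta> * c / 2 * (\<Sum>i\<in>UNIV. V (q $ i)) - ?N * (\<delta> * M + ?N * M')) +
      ?w * (?\<kappa> / (4 * ?N) * R - ?N * ?\<kappa>) \<le> force_pairing V q ?F"
    unfolding force_pairing_def .
  moreover have "?w * (\<delta> * c / 2 * (\<Sum>i\<in>UNIV. V (q $ i)) - ?N * (\<delta> * M + ?N * M')) +
      ?w * (?\<kappa> / (4 * ?N) * R - ?N * ?\<kappa>) =
      ?w * (\<delta> * c / 2 * (\<Sum>i\<in>UNIV. V (q $ i)) + ?\<kappa> / (4 * ?N) * R -
        ?N * (\<delta> * M + ?N * M' + ?\<kappa>))"
    by (simp add: algebra_simps)
  ultimately show ?thesis unfolding R_def by simp
qed

section \<open>Cost of the weight and coercivity of the force along the drift field\<close>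

lemma norm_sq_vec: "(norm (q :: 'a::real_inner ^ 'n))\<^sup>2 = (\<Sum>i\<in>UNIV. (norm (q $ i))\<^sup>2)"
  by (simp add: power2_norm_eq_inner inner_vec_def)

text \<open>Quadratic growth of \<open>V\<close> bounds the squared norm of \<open>q\<close> by the
  energy scale, so the weight decays no faster than the inverse square root of that scale.\<close>

lemma weight_ge_energy_scale:
  fixes V :: "real ^ 'd \<Rightarrow> real" and q :: "(real ^ 'd) ^ 'n"
  assumes \<eta>: "\<eta> > 0" and c: "c > 0" and M: "M > 0"
    and V: "\<And>x. V x \<ge> 0" "\<And>x. V x \<ge> c * (norm x)\<^sup>2 - M"
  shows "weight \<eta> q \<ge> 1 / sqrt ((1 + \<eta> / c + \<eta> * real CARD('n) * M / c) * (1 + energy_scale V q))"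
proof -
  let ?N = "real CARD('n)" and ?T = "energy_scale V q"
  have T: "?T \<ge> 0" using V by (intro energy_scale_nonneg)
  have "c * (norm q)\<^sup>2 = (\<Sum>i\<in>UNIV. c * (norm (q $ i))\<^sup>2)"
    by (simp add: norm_sq_vec sum_distrib_left)
  also have "\<dots> \<le> (\<Sum>i\<in>UNIV. V (q $ i) + M)"
    using V(2) by (intro sum_mono) (simp add: algebra_simps)
  also have "\<dots> = (\<Sum>i\<in>UNIV. V (q $ i)) + ?N * M"
    by (simp add: sum.distrib)
  also have "\<dots> \<le> ?T + ?N * M"
    unfolding energy_scale_def by (simp add: sum_nonneg)
  finally have "(norm q)\<^sup>2 \<le> (?T + ?N * M) / c" using c by (simp add: field_simps)
  then have "\<eta> * (norm q)\<^sup>2 \<le> \<eta> * ((?T + ?N * M) / c)" using \<eta> by (intro mult_left_mono) auto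
  then have "1 + \<eta> * (norm q)\<^sup>2 \<le> 1 + \<eta> / c * ?T + \<eta> * ?N * M / c"
    by (simp add: algebra_simps add_divide_distrib)
  also have "\<dots> \<le> (1 + \<eta> / c + \<eta> * ?N * M / c) * (1 + ?T)"
  proof -
    have "0 \<le> ?T + \<eta> / c + \<eta> * ?N * M / c * ?T"
      using T \<eta> c M by (intro add_nonneg_nonneg mult_nonneg_nonneg divide_nonneg_pos) auto
    then show ?thesis by (simp add: algebra_simps add_divide_distrib)
  qed
  finally have "sqrt (1 + \<eta> * (norm q)\<^sup>2) \<le> sqrt ((1 + \<eta> / c + \<eta> * ?N * M / c) * (1 + ?T))"
    by simp
  moreover have "sqrt (1 + \<eta> * (norm q)\<^sup>2) > 0" using \<eta> by (simp add: add_pos_nonneg)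
  ultimately have "1 / sqrt ((1 + \<eta> / c + \<eta> * ?N * M / c) * (1 + ?T)) \<le> 1 / sqrt (1 + \<eta> * (norm q)\<^sup>2)"
    by (intro divide_left_mono mult_pos_pos) linarith+
  then show ?thesis using \<eta> by (simp add: weight_sqrt)
qed

text \<open>The unweighted gain is linear in the energy scale T, and the weight is at least a
  multiple of (1 + T)^(-1/2), so growth of order sqrt (1 + T) remains. The additive errors stay
  bounded because the weight is at most 1.\<close>

lemma force_pairing_drift_field_coercive:
  fixes V :: "real ^ 'd \<Rightarrow> real"
  assumes d: "CARD('d) \<ge> 2" and V: "confining_potential V"
    and \<delta>: "0 < \<delta>" "\<delta> \<le> 1/2" and \<eta>: "\<eta> > 0"
  shows "\<exists>c>0. \<exists>C. \<forall>q\<in>(config_space :: ((real ^ 'd) ^ 'n) set).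
    force_pairing V q (drift_field \<delta> \<eta> q) \<ge> c * sqrt (1 + energy_scale V q) - C"
proof -
  let ?N = "real CARD('n)" and ?\<kappa> = "kernel_factor CARD('d)"
  obtain c1 c2 M where c: "c1 > 0" "c2 > 0" "M > 0"
    and V0: "\<And>x. V x \<ge> 0" and V1: "\<And>x. V x \<ge> c1 * (norm x)\<^sup>2 - M"
    and V2: "\<And>x. c2 * V x - M \<le> grad V x \<bullet> x"
    and V3: "\<forall>\<epsilon>>0. \<exists>M'>0. \<forall>x. norm (grad V x) \<le> \<epsilon> * V x + M'"
    using V unfolding confining_potential_def by blast
  have N: "?N \<ge> 1" using zero_less_card_finite[where 'a='n] by (simp add: Suc_leI)
  have \<kappa>: "?\<kappa> > 0" using d by (simp add: kernel_factor_def)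
  have "\<delta> * c2 / (2 * ?N) > 0" using \<delta> c N by (intro divide_pos_pos mult_pos_pos) auto
  with V3 obtain M' where M': "M' > 0" "\<And>x. norm (grad V x) \<le> \<delta> * c2 / (2 * ?N) * V x + M'"
    by blast
  \<comment> \<open>\<open>e\<close> is the smaller of the two gain coefficients in
    \<open>force_pairing_drift_field_ge\<close> and \<open>C\<close> is its error; \<open>B\<close>
    is the constant in \<open>weight_ge_energy_scale\<close>.\<close>
  define e where "e = min (\<delta> * c2 / 2) (?\<kappa> / (4 * ?N))"
  define B where "B = 1 + \<eta> / c1 + \<eta> * ?N * M / c1"
  define C where "C = ?N * (\<delta> * M + ?N * M' + ?\<kappa>)"
  have e: "e > 0" unfolding e_def using \<delta> c \<kappa> N by simp
  have B: "B > 0" unfolding B_def using \<eta> c by (intro add_pos_nonneg) auto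
  have C: "C \<ge> 0" unfolding C_def using \<delta> c M' \<kappa> by simp
  have "force_pairing V q (drift_field \<delta> \<eta> q) \<ge> e / sqrt B * sqrt (1 + energy_scale V q) - (e / sqrt B + C)"
    if q: "q \<in> config_space" for q :: "(real ^ 'd) ^ 'n"
  proof -
    let ?T = "energy_scale V q" and ?w = "weight \<eta> q"
    let ?R = "\<Sum>i\<in>UNIV. \<Sum>j\<in>UNIV - {i}. norm (q $ i - q $ j) powr (1 - real CARD('d))"
    note w = weight_bounds[OF \<eta>, of q]
    have T: "?T \<ge> 0" using V0 by (intro energy_scale_nonneg)
    then have sT: "sqrt (1 + ?T) \<ge> 1" by simp
    have "e * ?T \<le> \<delta> * c2 / 2 * (\<Sum>i\<in>UNIV. V (q $ i)) + ?\<kappa> / (4 * ?N) * ?R"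
      unfolding energy_scale_def distrib_left
      by (intro add_mono mult_right_mono sum_nonneg) (auto simp: e_def V0)
    then have "?w * (e * ?T - C) \<le> ?w * (\<delta> * c2 / 2 * (\<Sum>i\<in>UNIV. V (q $ i)) + ?\<kappa> / (4 * ?N) * ?R - C)"
      using w by (intro mult_left_mono) auto
    also have "\<dots> \<le> force_pairing V q (drift_field \<delta> \<eta> q)"
      unfolding C_def by (rule force_pairing_drift_field_ge[OF d \<delta> \<eta> V2 M'(2) q])
    finally have 1: "?w * (e * ?T - C) \<le> force_pairing V q (drift_field \<delta> \<eta> q)" .
    have "?w \<ge> 1 / sqrt (B * (1 + ?T))"
      unfolding B_def by (rule weight_ge_energy_scale[OF \<eta> c(1) c(3) V0 V1])
    then have "?w * (e * ?T) \<ge> 1 / sqrt (B * (1 + ?T)) * (e * ?T)"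
      using T e by (intro mult_right_mono) auto
    also have "1 / sqrt (B * (1 + ?T)) * (e * ?T) = e / sqrt B * (?T / sqrt (1 + ?T))"
      by (simp add: real_sqrt_mult)
    finally have 2: "?w * (e * ?T) \<ge> e / sqrt B * (?T / sqrt (1 + ?T))" .
    \<comment> \<open>Rewriting T as (1 + T) - 1 shows that T / sqrt (1 + T) falls short of sqrt (1
      + T) by at most 1; the extra constant \<open>e / sqrt B\<close> pays for this.\<close>
    have "?T = sqrt (1 + ?T) * sqrt (1 + ?T) - 1" using T by simp
    then have "?T / sqrt (1 + ?T) = sqrt (1 + ?T) - 1 / sqrt (1 + ?T)"
      using sT by (metis diff_divide_distrib nonzero_mult_div_cancel_left not_one_le_zero)
    also have "\<dots> \<ge> sqrt (1 + ?T) - 1" using sT by simp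
    finally have "e / sqrt B * (?T / sqrt (1 + ?T)) \<ge> e / sqrt B * (sqrt (1 + ?T) - 1)"
      using e B by (intro mult_left_mono) auto
    moreover have "?w * C \<le> 1 * C" using w C by (intro mult_right_mono) auto
    ultimately show ?thesis using 1 2 by (simp add: algebra_simps)
  qed
  moreover have "e / sqrt B > 0" using e B by simp
  ultimately show ?thesis by blast
qed

subsection \<open>The Lyapunov function\<close>

lemma young_product:
  fixes s b x :: real
  assumes "s > 0"
  shows "b * x \<le> s * x\<^sup>2 + b\<^sup>2 / (4 * s)"
proof -
  have "0 \<le> s * (x - b / (2 * s))\<^sup>2" using assms by simp
  also have "\<dots> = s * x\<^sup>2 - b * x + b\<^sup>2 / (4 * s)"
    using assms by (simp add: power2_eq_square field_simps)
  finally show ?thesis by simp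
qed

text \<open>The field is bounded, so the correction is at most linear in the momentum, while the
  energy is quadratic in the momentum up to a lower bound on the potential energy.\<close>

lemma little_o_hamiltonian_drift_field:
  fixes V :: "real ^ 'd \<Rightarrow> real"
  assumes d: "CARD('d) \<ge> 2" and V: "confining_potential V" and "\<delta> > 0" "\<eta> > 0"
  shows "little_o_hamiltonian V
    (\<lambda>x :: ((real ^ 'd) ^ 'n) \<times> ((real ^ 'd) ^ 'n). drift_field \<delta> \<eta> (fst x) \<bullet> snd x)"
  unfolding little_o_hamiltonian_def
proof (intro allI impI)
  fix \<epsilon> :: real assume \<epsilon>: "\<epsilon> > 0"
  obtain c1 M where c: "c1 > 0" and V1: "\<And>x. V x \<ge> c1 * (norm x)\<^sup>2 - M"
    using V unfolding confining_potential_def by blast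
  define L where "L = real CARD('n) * (M + 1 / (4 * c1))"
  define f where "f = \<delta> / sqrt \<eta> + (real CARD('n))\<^sup>2"
  \<comment> \<open>Chosen so that \<open>L + 2 * f\<^sup>2 / \<epsilon>\<^sup>2\<close> is below
    the Hamiltonian, which lets the second half of \<open>\<epsilon>\<close> times the Hamiltonian
    absorb the constants left by Young's inequality.\<close>
  define R where "R = \<bar>L\<bar> + 2 * f\<^sup>2 / \<epsilon>\<^sup>2 + 1"
  have "R > 0" using \<epsilon> by (simp add: R_def add_nonneg_pos)
  moreover have "\<bar>drift_field \<delta> \<eta> (fst x) \<bullet> snd x\<bar> \<le> \<epsilon> * hamiltonian V x"
    if x: "x \<in> phase_space" "hamiltonian V x \<ge> R" for x :: "((real ^ 'd) ^ 'n) \<times> ((real ^ 'd) ^ 'n)"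
  proof -
    obtain q p where [simp]: "x = (q, p)" by fastforce
    have q: "q \<in> config_space" using x by (simp add: phase_space_def)
    have "hamiltonian V x \<ge> 1/2 * (norm p)\<^sup>2 - L"
      using potential_energy_bounded_below[OF d c V1 q] by (simp add: hamiltonian_def L_def)
    then have p: "(norm p)\<^sup>2 \<le> 2 * (hamiltonian V x + L)" by simp
    have "\<bar>drift_field \<delta> \<eta> q \<bullet> p\<bar> \<le> f * norm p"
      using Cauchy_Schwarz_ineq2[of "drift_field \<delta> \<eta> q" p] norm_drift_field_le[of \<eta> \<delta> q] assms
      by (intro order_trans[OF Cauchy_Schwarz_ineq2] mult_right_mono) (auto simp: f_def)
    also have "\<dots> \<le> \<epsilon> / 4 * (norm p)\<^sup>2 + f\<^sup>2 / (4 * (\<epsilon> / 4))"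
      using \<epsilon> by (intro young_product) auto
    also have "\<dots> \<le> \<epsilon> / 4 * (2 * (hamiltonian V x + L)) + f\<^sup>2 / \<epsilon>"
      using \<epsilon> p by (intro add_mono mult_left_mono) auto
    also have "\<dots> = \<epsilon> / 2 * (hamiltonian V x + (L + 2 * f\<^sup>2 / \<epsilon>\<^sup>2))"
      using \<epsilon> by (simp add: field_simps power2_eq_square)
    also have "\<dots> \<le> \<epsilon> / 2 * (hamiltonian V x + hamiltonian V x)"
    proof -
      have "L + 2 * f\<^sup>2 / \<epsilon>\<^sup>2 \<le> hamiltonian V x" using x(2) unfolding R_def by linarith
      then show ?thesis using \<epsilon> by (intro mult_left_mono add_left_mono) auto
    qed
    also have "\<dots> = \<epsilon> * hamiltonian V x" by simp
    finally show ?thesis by simp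
  qed
  ultimately show "\<exists>R>0. \<forall>x\<in>phase_space. hamiltonian V x \<ge> R \<longrightarrow>
      \<bar>drift_field \<delta> \<eta> (fst (x :: ((real ^ 'd) ^ 'n) \<times> ((real ^ 'd) ^ 'n))) \<bullet> snd x\<bar>
        \<le> \<epsilon> * hamiltonian V x"
    by blast
qed

text \<open>For large energy the correction is at least -(a/2) H, so the exponent is at least (a/2)
  H.\<close>

lemma filterlim_exp_hamiltonian:
  fixes \<Psi> :: "((real ^ 'd) ^ 'n) \<times> ((real ^ 'd) ^ 'n) \<Rightarrow> real"
  assumes "a > 0" and \<Psi>: "little_o_hamiltonian V \<Psi>"
  shows "filterlim (\<lambda>x. exp (a * hamiltonian V x + \<Psi> x)) at_top (hamiltonian_at_top V)"
proof -
  let ?G = "hamiltonian_at_top V :: (((real ^ 'd) ^ 'n) \<times> ((real ^ 'd) ^ 'n)) filter"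
  obtain R where R: "\<And>x. x \<in> phase_space \<Longrightarrow> hamiltonian V x \<ge> R \<Longrightarrow>
      \<bar>\<Psi> x\<bar> \<le> a / 2 * hamiltonian V x"
    using \<Psi> assms(1) unfolding little_o_hamiltonian_def by (meson half_gt_zero)
  have lim: "filterlim (hamiltonian V) at_top ?G"
    unfolding hamiltonian_at_top_def
    by (rule filterlim_mono[OF filterlim_filtercomap order_refl inf_le1])
  have "filterlim (\<lambda>x. exp (a / 2 * hamiltonian V x)) at_top ?G"
    using assms(1)
    by (intro filterlim_compose[OF exp_at_top] filterlim_tendsto_pos_mult_at_top[OF tendsto_const _ lim]) auto
  moreover have "\<forall>\<^sub>F x in ?G. exp (a / 2 * hamiltonian V x) \<le> exp (a * hamiltonian V x + \<Psi> x)"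
  proof -
    have "\<forall>\<^sub>F x in ?G. x \<in> phase_space"
      unfolding hamiltonian_at_top_def by (simp add: eventually_inf_principal)
    moreover have "\<forall>\<^sub>F x in ?G. hamiltonian V x \<ge> R"
      using lim unfolding filterlim_at_top by blast
    ultimately show ?thesis
    proof eventually_elim
      case (elim x)
      from R[OF elim] show ?case by (simp add: abs_le_iff)
    qed
  qed
  ultimately show ?thesis by (rule filterlim_at_top_mono)
qed

text \<open>The generator multiplies W by a factor B that is bounded above and tends to minus
  infinity with the momentum or the energy scale. Where B \<le> -1 the claim is immediate; elsewhere
  W itself is bounded, and a constant covers the excess W (B + 1).\<close>

lemma drift_inequality:
  fixes V :: "real ^ 'd \<Rightarrow> real" and \<gamma> \<beta> a :: real
  assumes d: "CARD('d) \<ge> 2" and \<gamma>: "\<gamma> > 0" and \<beta>: "\<beta> > 0"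
    and V: "confining_potential V" and a: "0 < a" "a < \<beta>"
  shows "\<exists>\<delta>>0. \<exists>\<eta>>0. \<exists>C>0. \<forall>x\<in>phase_space.
    generator V \<gamma> \<beta> (\<lambda>x :: ((real ^ 'd) ^ 'n) \<times> ((real ^ 'd) ^ 'n).
        exp (a * hamiltonian V x + drift_field \<delta> \<eta> (fst x) \<bullet> snd x)) x
      \<le> - exp (a * hamiltonian V x + drift_field \<delta> \<eta> (fst x) \<bullet> snd x) + C"
proof -
  let ?N = "real CARD('n)"
  have N: "?N > 0" by simp
  \<comment> \<open>The net dissipation rate of friction against noise, positive because a <
    \<beta>. All small parameters are measured against it.\<close>
  define \<tau> where "\<tau> = \<gamma> * a * (1 - a / \<beta>)"
  have \<tau>: "\<tau> > 0" unfolding \<tau>_def using \<gamma> a \<beta> by (intro mult_pos_pos) auto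
  \<comment> \<open>Together with the choice of \<open>\<eta>\<close>, for which sqrt \<eta> N^2 =
    \<tau>/4, this makes the quadratic form of the field cost at most \<tau>/2. The bound 1/2 is
    what coercivity requires.\<close>
  define \<delta> where "\<delta> = min (1/2) (\<tau> / 8)"
  have \<delta>: "0 < \<delta>" "\<delta> \<le> 1/2" "\<delta> \<le> \<tau> / 8" using \<tau> by (auto simp: \<delta>_def)
  define \<eta> where "\<eta> = (\<tau> / (4 * ?N\<^sup>2))\<^sup>2"
  have \<eta>: "\<eta> > 0" using \<tau> N by (simp add: \<eta>_def)
  have s\<eta>: "sqrt \<eta> * ?N\<^sup>2 = \<tau> / 4"
    unfolding \<eta>_def using \<tau> N by (simp add: real_sqrt_abs)
  have coef: "2 * \<delta> + sqrt \<eta> * ?N\<^sup>2 \<le> \<tau> / 2" unfolding s\<eta> using \<delta> by simp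
  have C2V: "C2_on V UNIV" and V0: "\<And>x. V x \<ge> 0" using V unfolding confining_potential_def by auto
  obtain c C0 where c: "c > 0" and coer: "\<And>q :: (real ^ 'd) ^ 'n. q \<in> config_space \<Longrightarrow>
      force_pairing V q (drift_field \<delta> \<eta> q) \<ge> c * sqrt (1 + energy_scale V q) - C0"
    using force_pairing_drift_field_coercive[OF d V \<delta>(1,2) \<eta>, where 'n='n] by blast
  define f where "f = \<delta> / sqrt \<eta> + ?N\<^sup>2"
  have f: "norm (drift_field \<delta> \<eta> q) \<le> f" for q :: "(real ^ 'd) ^ 'n"
    unfolding f_def using \<eta> \<delta> by (intro norm_drift_field_le) auto
  have f0: "f \<ge> 0" using f norm_ge_zero order_trans by blast
  define b where "b = \<bar>\<gamma> * (1 - 2 * a / \<beta>)\<bar> * f"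
  define D0 where "D0 = \<gamma> * a / \<beta> * DIM((real ^ 'd) ^ 'n)"
  \<comment> \<open>\<open>K\<close> collects the constants in the upper bound on the factor
    \<open>B\<close>. \<open>P\<close> and \<open>T\<close> bound the squared momentum and the
    energy scale where \<open>B > -1\<close>, and \<open>Wm\<close> is the resulting bound on
    \<open>W\<close>.\<close>
  define K where "K = b\<^sup>2 / \<tau> + D0 + \<gamma> / \<beta> * f\<^sup>2 + C0"
  define P where "P = 4 * \<bar>K + 1\<bar> / \<tau>"
  define T where "T = (\<bar>K + 1\<bar> / c)\<^sup>2"
  define Wm where "Wm = exp (a * (P / 2 + T + ?N) + (f\<^sup>2 + P))"
  define W where "W = (\<lambda>x :: ((real ^ 'd) ^ 'n) \<times> ((real ^ 'd) ^ 'n).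
    exp (a * hamiltonian V x + drift_field \<delta> \<eta> (fst x) \<bullet> snd x))"
  have "generator V \<gamma> \<beta> W (q, p) \<le> - W (q, p) + (\<bar>K + 1\<bar> + 1) * Wm"
    if q: "q \<in> config_space" for q p :: "(real ^ 'd) ^ 'n"
  proof -
    let ?F = "drift_field \<delta> \<eta> q" and ?S = "energy_scale V q"
    have S: "?S \<ge> 0" using V0 by (rule energy_scale_nonneg)
    obtain D where D: "((\<lambda>q. drift_field \<delta> \<eta> q \<bullet> p) has_derivative D) (at q)"
      "D p \<le> (2 * \<delta> + sqrt \<eta> * ?N\<^sup>2) * (norm p)\<^sup>2"
      using drift_field_derivative[OF q \<eta> \<delta>(1)] by blast
    define B where "B = D p - force_pairing V q ?F - \<gamma> * a * (1 - a / \<beta>) * (norm p)\<^sup>2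
       + \<gamma> * a / \<beta> * DIM((real ^ 'd) ^ 'n) - \<gamma> * (1 - 2 * a / \<beta>) * (?F \<bullet> p) + \<gamma> / \<beta> * (norm ?F)\<^sup>2"
    have gen: "generator V \<gamma> \<beta> W (q, p) = W (q, p) * B"
      unfolding B_def by (rule generator_exp[OF potential_energy_has_derivative[OF d C2V q] D(1) W_def])
    have Fp: "\<bar>?F \<bullet> p\<bar> \<le> f * norm p"
      by (intro order_trans[OF Cauchy_Schwarz_ineq2] mult_right_mono f) auto
    have "D p \<le> \<tau> / 2 * (norm p)\<^sup>2"
      using D(2) mult_right_mono[OF coef, of "(norm p)\<^sup>2"] by simp
    \<comment> \<open>Young's inequality spends a further quarter of \<open>\<tau>\<close> on the
      term linear in the momentum, so a quarter is left over.\<close>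
    moreover have "- (\<gamma> * (1 - 2 * a / \<beta>) * (?F \<bullet> p)) \<le> \<tau> / 4 * (norm p)\<^sup>2 + b\<^sup>2 / \<tau>"
    proof -
      have "- (\<gamma> * (1 - 2 * a / \<beta>) * (?F \<bullet> p)) \<le> \<bar>\<gamma> * (1 - 2 * a / \<beta>)\<bar> * \<bar>?F \<bullet> p\<bar>"
        by (simp only: abs_mult[symmetric] abs_ge_minus_self)
      also have "\<dots> \<le> \<bar>\<gamma> * (1 - 2 * a / \<beta>)\<bar> * (f * norm p)"
        by (intro mult_left_mono Fp) auto
      also have "\<dots> = b * norm p" by (simp add: b_def)
      also have "\<dots> \<le> \<tau> / 4 * (norm p)\<^sup>2 + b\<^sup>2 / (4 * (\<tau> / 4))"
        using \<tau> by (intro young_product) auto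
      finally show ?thesis by simp
    qed
    moreover have "\<gamma> / \<beta> * (norm ?F)\<^sup>2 \<le> \<gamma> / \<beta> * f\<^sup>2"
      using \<gamma> \<beta> f by (intro mult_left_mono power_mono) auto
    ultimately have B: "B \<le> K - \<tau> / 4 * (norm p)\<^sup>2 - c * sqrt (1 + ?S)"
      unfolding B_def \<tau>_def[symmetric] D0_def[symmetric] K_def using coer[OF q] by (simp add: algebra_simps)
    have Wpos: "W (q, p) > 0" by (simp add: W_def)
    have Wm: "Wm > 0" by (simp add: Wm_def)
    show ?thesis
    proof (cases "B \<le> -1")
      case True
      then have "W (q, p) * B \<le> W (q, p) * (-1)" using Wpos by (intro mult_left_mono) auto
      moreover have "(\<bar>K + 1\<bar> + 1) * Wm \<ge> 0" using Wm by simp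
      ultimately show ?thesis unfolding gen by simp
    next
      \<comment> \<open>Both negative terms in the bound on \<open>B\<close> now have sum below
        \<open>K + 1\<close>. Each is nonnegative in size, so momentum and energy scale are bounded
        separately.\<close>
      case False
      have nn: "\<tau> / 4 * (norm p)\<^sup>2 \<ge> 0" "c * sqrt (1 + ?S) \<ge> 0" using \<tau> c S by auto
      have "\<tau> / 4 * (norm p)\<^sup>2 \<le> \<bar>K + 1\<bar>" using B False nn by linarith
      then have P: "(norm p)\<^sup>2 \<le> P" unfolding P_def using \<tau> by (simp add: field_simps)
      have "c * sqrt (1 + ?S) \<le> \<bar>K + 1\<bar>" using B False nn by linarith
      then have "sqrt (1 + ?S) \<le> \<bar>K + 1\<bar> / c" using c by (simp add: field_simps)
      then have "(sqrt (1 + ?S))\<^sup>2 \<le> T" unfolding T_def using S by (intro power_mono) auto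
      then have T: "?S \<le> T" using S by simp
      have "hamiltonian V (q, p) \<le> P / 2 + T + ?N"
        using potential_energy_le_energy_scale[OF d q, of V] P T by (simp add: hamiltonian_def)
      moreover have "?F \<bullet> p \<le> f\<^sup>2 + P"
      proof -
        have "?F \<bullet> p \<le> f * norm p" using Fp by linarith
        also have "\<dots> \<le> 1 * (norm p)\<^sup>2 + f\<^sup>2 / (4 * 1)" by (rule young_product) simp
        also have "\<dots> \<le> f\<^sup>2 + P" using P zero_le_power2[of f] by linarith
        finally show ?thesis .
      qed
      ultimately have "W (q, p) \<le> Wm"
        unfolding W_def Wm_def fst_conv snd_conv exp_le_cancel_iff
        using a by (intro add_mono mult_left_mono) auto
      moreover have "B + 1 \<le> \<bar>K + 1\<bar> + 1" using B nn by linarith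
      ultimately have "W (q, p) * (B + 1) \<le> Wm * (\<bar>K + 1\<bar> + 1)"
        using False Wpos Wm by (intro mult_mono) auto
      then show ?thesis unfolding gen by (simp add: algebra_simps)
    qed
  qed
  moreover have "(\<bar>K + 1\<bar> + 1) * Wm > 0" by (simp add: Wm_def add_nonneg_pos)
  ultimately show ?thesis
    unfolding W_def phase_space_def using \<delta>(1) \<eta>
    by (intro exI[of _ \<delta>] exI[of _ \<eta>] exI[of _ "(\<bar>K + 1\<bar> + 1) * Wm"] conjI ballI) auto
qed

theorem proposition2p7:
  fixes V :: "real ^ 'd \<Rightarrow> real" and \<gamma> \<beta> a :: real
  assumes "CARD('d) \<ge> 2" and "CARD('n::finite) \<ge> 2"
    and "\<gamma> > 0" and "\<beta> > 0"
    and "confining_potential V"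
    and "a \<in> {0<..<\<beta>}"
  shows "\<exists>(W :: ((real ^ 'd) ^ 'n) \<times> ((real ^ 'd) ^ 'n) \<Rightarrow> real)
           (\<Psi> :: ((real ^ 'd) ^ 'n) \<times> ((real ^ 'd) ^ 'n) \<Rightarrow> real).
      C2_on W phase_space \<and> (\<forall>x\<in>phase_space. W x > 0) \<and>
      C2_on \<Psi> phase_space \<and>
      (\<forall>x\<in>phase_space. W x = exp (a * hamiltonian V x + \<Psi> x)) \<and>
      little_o_hamiltonian V \<Psi> \<and>
      filterlim W at_top (hamiltonian_at_top V) \<and>
      (\<exists>lam C. lam > 0 \<and> C > 0 \<and>
        (\<forall>x\<in>phase_space. generator V \<gamma> \<beta> W x \<le> - lam * W x + C))"
proof -
  have a: "0 < a" "a < \<beta>" using assms(6) by auto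
  obtain \<delta> \<eta> C where \<delta>: "\<delta> > 0" and \<eta>: "\<eta> > 0" and C: "C > 0"
    and gen: "\<forall>x\<in>phase_space.
    generator V \<gamma> \<beta> (\<lambda>x :: ((real ^ 'd) ^ 'n) \<times> ((real ^ 'd) ^ 'n).
        exp (a * hamiltonian V x + drift_field \<delta> \<eta> (fst x) \<bullet> snd x)) x
      \<le> - exp (a * hamiltonian V x + drift_field \<delta> \<eta> (fst x) \<bullet> snd x) + C"
    using drift_inequality[OF assms(1,3,4,5) a, where 'n='n] by blast
  define \<Psi> where "\<Psi> = (\<lambda>x :: ((real ^ 'd) ^ 'n) \<times> ((real ^ 'd) ^ 'n). drift_field \<delta> \<eta> (fst x) \<bullet> snd x)"
  define W where "W = (\<lambda>x. exp (a * hamiltonian V x + \<Psi> x))"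
  have V: "C2_on V UNIV" using assms(5) by (simp add: confining_potential_def)
  have \<Psi>: "C2_on \<Psi> phase_space" unfolding \<Psi>_def by (rule C2_on_drift_field[OF \<eta>])
  have o: "little_o_hamiltonian V \<Psi>"
    unfolding \<Psi>_def by (rule little_o_hamiltonian_drift_field[OF assms(1,5) \<delta> \<eta>])
  have "C2_on W phase_space"
    unfolding W_def by (intro C2_on_exp C2_on_add C2_on_mult C2_on_const C2_on_hamiltonian assms(1) V \<Psi>)
  moreover have "filterlim W at_top (hamiltonian_at_top V)"
    unfolding W_def by (rule filterlim_exp_hamiltonian[OF a(1) o])
  \<comment> \<open>The threshold -1 used for the factor in \<open>drift_inequality\<close> makes
    the decay rate \<open>lam\<close> equal to 1.\<close>
  moreover have "\<forall>x\<in>phase_space. generator V \<gamma> \<beta> W x \<le> - 1 * W x + C"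
    using gen by (simp add: W_def \<Psi>_def)
  ultimately show ?thesis
    using \<Psi> o C by (intro exI[of _ W] exI[of _ \<Psi>] exI[of _ 1] conjI exI[of _ C]) (auto simp: W_def)
qed

end
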